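(* Let $T$ and $T'$ be caterpillars whose leaf numbers are strictly positive and pairwise distinct (within each caterpillar). If ${\mathbf X}_T={\mathbf X}_{T'}$, then $T$ and $T'$ are isomorphic. (That is, a caterpillar whose leaf numbers are strictly positive and distinct can be reconstructed from its chromatic symmetric function.)
   Context: A caterpillar is a tree in which the subgraph induced on the non-leaf vertices is a path with at least one edge (the spine), with vertices $v_0,\dots,v_s$ in order. The $i$-th leaf number $f_i$ is the number of leaves adjacent to $v_i$. For a graph $G$, ${\mathbf X}_G=\sum_\kappa\prod_{v\in V(G)}x_{\kappa(v)}$, summed over all proper colorings $\kappa:V(G)\to\{1,2,\dots\}$ (adjacent vertices receive distinct colors), in commuting indeterminates $x_1,x_2,\dots$. *)

theory Defs
  imports "HOL-Library.Multiset" "HOL-Library.FuncSet"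
begin

record 'a sgraph =
  gverts :: "'a set"
  gedges :: "'a set set"

definition simple_graph :: "'a sgraph \<Rightarrow> bool" where
  "simple_graph G \<longleftrightarrow> finite (gverts G) \<and> (\<forall>e \<in> gedges G. e \<subseteq> gverts G \<and> card e = 2)"

definition gadj :: "'a sgraph \<Rightarrow> 'a \<Rightarrow> 'a \<Rightarrow> bool" where
  "gadj G u v \<longleftrightarrow> {u, v} \<in> gedges G"

definition gwalk :: "'a sgraph \<Rightarrow> 'a list \<Rightarrow> bool" where
  "gwalk G p \<longleftrightarrow> p \<noteq> [] \<and> set p \<subseteq> gverts G \<and>
     (\<forall>i. Suc i < length p \<longrightarrow> gadj G (p ! i) (p ! Suc i))"

definition gconnected :: "'a sgraph \<Rightarrow> bool" where
  "gconnected G \<longleftrightarrow> gverts G \<noteq> {} \<and>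
     (\<forall>u \<in> gverts G. \<forall>v \<in> gverts G. \<exists>p. gwalk G p \<and> hd p = u \<and> last p = v)"

text \<open>A cycle is given by the list of its vertices, without repeating the initial one.\<close>

definition gcycle :: "'a sgraph \<Rightarrow> 'a list \<Rightarrow> bool" where
  "gcycle G p \<longleftrightarrow> gwalk G p \<and> 3 \<le> length p \<and> distinct p \<and> gadj G (last p) (hd p)"

definition is_tree :: "'a sgraph \<Rightarrow> bool" where
  "is_tree G \<longleftrightarrow> simple_graph G \<and> gconnected G \<and> (\<nexists>p. gcycle G p)"

definition gdegree :: "'a sgraph \<Rightarrow> 'a \<Rightarrow> nat" where
  "gdegree G v = card {e \<in> gedges G. v \<in> e}"

definition leaves :: "'a sgraph \<Rightarrow> 'a set" where
  "leaves G = {v \<in> gverts G. gdegree G v = 1}"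

definition ginduced :: "'a sgraph \<Rightarrow> 'a set \<Rightarrow> 'a sgraph" where
  "ginduced G S = \<lparr> gverts = gverts G \<inter> S, gedges = {e \<in> gedges G. e \<subseteq> S} \<rparr>"

definition path_graph :: "'a list \<Rightarrow> 'a sgraph" where
  "path_graph vs = \<lparr> gverts = set vs, gedges = {{vs ! i, vs ! Suc i} | i. Suc i < length vs} \<rparr>"

text \<open>The list \<open>vs\<close> is \<open>v\<^sub>0, \<dots>, v\<^sub>s\<close>; a path with at least one edge has \<open>s \<ge> 1\<close>.\<close>

definition is_spine :: "'a sgraph \<Rightarrow> 'a list \<Rightarrow> bool" where
  "is_spine T vs \<longleftrightarrow> distinct vs \<and> 2 \<le> length vs \<and>
     ginduced T (gverts T - leaves T) = path_graph vs"

definition caterpillar :: "'a sgraph \<Rightarrow> bool" where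
  "caterpillar T \<longleftrightarrow> is_tree T \<and> (\<exists>vs. is_spine T vs)"

definition leaf_number :: "'a sgraph \<Rightarrow> 'a list \<Rightarrow> nat \<Rightarrow> nat" where
  "leaf_number T vs i = card {u \<in> leaves T. gadj T (vs ! i) u}"

definition graph_iso :: "'a sgraph \<Rightarrow> 'b sgraph \<Rightarrow> bool" where
  "graph_iso G H \<longleftrightarrow> (\<exists>f. bij_betw f (gverts G) (gverts H) \<and>
     (\<forall>u \<in> gverts G. \<forall>v \<in> gverts G. gadj G u v \<longleftrightarrow> gadj H (f u) (f v)))"

definition proper_colorings :: "'a sgraph \<Rightarrow> ('a \<Rightarrow> nat) set" where
  "proper_colorings G = {\<kappa> \<in> gverts G \<rightarrow>\<^sub>E {1..}.
     \<forall>u \<in> gverts G. \<forall>v \<in> gverts G. gadj G u v \<longrightarrow> \<kappa> u \<noteq> \<kappa> v}"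

text \<open>
  A monomial in the commuting indeterminates \<open>x\<^sub>1, x\<^sub>2, \<dots>\<close> is encoded as the multiset of the indices
  of its factors, so that the product of monomials is the sum of multisets.
  A formal power series over \<open>\<int>\<close> is the function sending each monomial to its coefficient.
\<close>

type_synonym mpower_series = "nat multiset \<Rightarrow> int"

definition color_monomial :: "'a sgraph \<Rightarrow> ('a \<Rightarrow> nat) \<Rightarrow> nat multiset" where
  "color_monomial G \<kappa> = (\<Sum>v \<in> gverts G. {#\<kappa> v#})"

definition chromatic_sym :: "'a sgraph \<Rightarrow> mpower_series" where
  "chromatic_sym G m = int (card {\<kappa> \<in> proper_colorings G. color_monomial G \<kappa> = m})"

text \<open>The coefficients count finite sets, so \<^const>\<open>card\<close> does not take its default value 0.\<close>

lemma finite_colorings_of_monomial: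
  assumes "finite (gverts G)"
  shows "finite {\<kappa> \<in> proper_colorings G. color_monomial G \<kappa> = m}"
proof (rule finite_subset)
  show "{\<kappa> \<in> proper_colorings G. color_monomial G \<kappa> = m} \<subseteq> gverts G \<rightarrow>\<^sub>E set_mset m"
    using assms
    by (auto simp: proper_colorings_def color_monomial_def set_mset_sum PiE_iff extensional_def)
  show "finite (gverts G \<rightarrow>\<^sub>E set_mset m)"
    using assms by (intro finite_PiE) auto
qed

end

theory Submission
  imports Defs
begin

text \<open>
  By inclusion-exclusion, \<open>X\<^sub>G\<close> is the sum of \<open>(-1)\<^bsup>|S|\<^esup> p\<^bsub>\<lambda>(S)\<^esub>\<close> over all edge sets \<open>S\<close>, where \<open>\<lambda>(S)\<close> is
  the partition formed by the component sizes of \<open>(V, S)\<close>. The power sums \<open>p\<^sub>\<mu>\<close> are linearly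
  independent, so \<open>X\<^sub>G\<close> determines the signed count of the \<open>S\<close> with \<open>\<lambda>(S) = \<mu>\<close>, for every \<open>\<mu>\<close>.

  In a caterpillar, \<open>\<lambda>(S)\<close> has no part 1 only if \<open>S\<close> contains every leaf edge. Among these \<open>S\<close>,
  the one with the most components consists of the leaf edges alone and has the parts
  \<open>a\<^sub>i = f\<^sub>i + 1\<close>; those with one component fewer add a single spine edge, which replaces \<open>a\<^sub>i\<close> and
  \<open>a\<^sub>i\<^sub>+\<^sub>1\<close> by their sum. Hence \<open>X\<^sub>T\<close> determines the numbers \<open>a\<^sub>i\<close> and which pairs of them are
  adjacent on the spine. When the \<open>a\<^sub>i\<close> are distinct, this is the caterpillar up to isomorphism.
\<close>

section \<open>Linear independence of power sums\<close>

lemma count_image_mset_set: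
  assumes "finite I"
  shows "count (image_mset w (mset_set I)) k = card {i \<in> I. w i = k}"
  using assms by (simp add: count_image_mset' eq_commute)

text \<open>Each label has equally many indices on both sides, so bijections between the fibres
  exist and glue together. Later uses match the parts of equal partitions, then the spine positions,
  then the leaves of two caterpillars.\<close>

lemma ex_bij_betw_fibrewise:
  assumes "finite I" "finite J" and "\<And>k. card {i \<in> I. w i = k} = card {j \<in> J. w' j = k}"
  obtains h where "bij_betw h I J" and "\<And>i. i \<in> I \<Longrightarrow> w' (h i) = w i"
proof -
  have "\<forall>k. \<exists>h. bij_betw h {i \<in> I. w i = k} {j \<in> J. w' j = k}"
    using assms by (auto intro!: finite_same_card_bij)
  then obtain H where H: "\<And>k. bij_betw (H k) {i \<in> I. w i = k} {j \<in> J. w' j = k}"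
    by metis
  define h where "h i = H (w i) i" for i
  have h: "h i \<in> J \<and> w' (h i) = w i" if "i \<in> I" for i
    using that H[of "w i"] unfolding h_def bij_betw_def by blast
  have "inj_on h I"
  proof (rule inj_onI)
    fix x y assume xy: "x \<in> I" "y \<in> I" "h x = h y"
    then have "w x = w y" using h by metis
    then show "x = y"
      using xy H[of "w x"] unfolding h_def bij_betw_def inj_on_def by auto
  qed
  moreover have "J \<subseteq> h ` I"
  proof
    fix j assume "j \<in> J"
    then have "j \<in> H (w' j) ` {i \<in> I. w i = w' j}"
      using H[of "w' j"] unfolding bij_betw_def by blast
    then obtain i where "i \<in> I" "w i = w' j" "j = H (w' j) i" by blast
    then have "j = h i" by (simp add: h_def)
    then show "j \<in> h ` I" using \<open>i \<in> I\<close> by blast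
  qed
  ultimately have "bij_betw h I J"
    using h by (auto simp: bij_betw_def)
  then show ?thesis using that h by blast
qed

text \<open>\<open>family_count I w m\<close> is the coefficient of the monomial \<open>m\<close> in \<open>\<Prod>i\<in>I. p\<^bsub>w i\<^esub>\<close>, where
  \<open>p\<^sub>k = x\<^sub>1\<^sup>k + x\<^sub>2\<^sup>k + \<dots>\<close>, and \<open>power_sum \<mu> m\<close> is its coefficient in \<open>p\<^sub>\<mu>\<close>.\<close>

definition family_count :: "'i set \<Rightarrow> ('i \<Rightarrow> nat) \<Rightarrow> nat multiset \<Rightarrow> nat" where
  "family_count I w m =
     card {g \<in> I \<rightarrow>\<^sub>E {1..}. (\<Sum>i\<in>I. replicate_mset (w i) (g i)) = m}"

definition power_sum :: "nat multiset \<Rightarrow> nat multiset \<Rightarrow> nat" where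
  "power_sum \<mu> m = family_count {..<size \<mu>} (\<lambda>i. sorted_list_of_multiset \<mu> ! i) m"

lemma family_count_cong_bij:
  assumes h: "bij_betw h I J" and w: "\<And>i. i \<in> I \<Longrightarrow> w' (h i) = w i"
  shows "family_count I w m = family_count J w' m"
proof -
  have inj: "inj_on h I" and img: "h ` I = J" using h by (auto simp: bij_betw_def)
  define k where "k = inv_into I h"
  have k: "k (h i) = i" if "i \<in> I" for i
    using that inj by (simp add: k_def)
  have hk: "h (k j) = j" "k j \<in> I" if "j \<in> J" for j
    using that img by (auto simp: k_def f_inv_into_f inv_into_into)
  have mon: "(\<Sum>j\<in>J. replicate_mset (w' j) (g j)) = (\<Sum>i\<in>I. replicate_mset (w i) (g (h i)))" for g
    unfolding img[symmetric] using inj w by (simp add: sum.reindex)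
  have "bij_betw (\<lambda>g. restrict (g \<circ> h) I)
      {g \<in> J \<rightarrow>\<^sub>E {1..}. (\<Sum>i\<in>J. replicate_mset (w' i) (g i)) = m}
      {g \<in> I \<rightarrow>\<^sub>E {1..}. (\<Sum>i\<in>I. replicate_mset (w i) (g i)) = m}"
  proof (rule bij_betw_byWitness[where f' = "\<lambda>g. restrict (g \<circ> k) J"])
    show "\<forall>g\<in>{g \<in> J \<rightarrow>\<^sub>E {1..}. (\<Sum>i\<in>J. replicate_mset (w' i) (g i)) = m}.
        restrict (restrict (g \<circ> h) I \<circ> k) J = g"
      by (auto simp: fun_eq_iff restrict_def hk PiE_def extensional_def)
    show "\<forall>g\<in>{g \<in> I \<rightarrow>\<^sub>E {1..}. (\<Sum>i\<in>I. replicate_mset (w i) (g i)) = m}.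
        restrict (restrict (g \<circ> k) J \<circ> h) I = g"
      using img by (auto simp: fun_eq_iff restrict_def k PiE_def extensional_def)
    show "(\<lambda>g. restrict (g \<circ> h) I) `
      {g \<in> J \<rightarrow>\<^sub>E {1..}. (\<Sum>i\<in>J. replicate_mset (w' i) (g i)) = m}
      \<subseteq> {g \<in> I \<rightarrow>\<^sub>E {1..}. (\<Sum>i\<in>I. replicate_mset (w i) (g i)) = m}"
      using img by (auto simp: mon)
    show "(\<lambda>g. restrict (g \<circ> k) J) `
      {g \<in> I \<rightarrow>\<^sub>E {1..}. (\<Sum>i\<in>I. replicate_mset (w i) (g i)) = m}
      \<subseteq> {g \<in> J \<rightarrow>\<^sub>E {1..}. (\<Sum>i\<in>J. replicate_mset (w' i) (g i)) = m}"
    proof (rule image_subsetI)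
      fix g assume "g \<in> {g \<in> I \<rightarrow>\<^sub>E {1..}. (\<Sum>i\<in>I. replicate_mset (w i) (g i)) = m}"
      then have g: "g \<in> I \<rightarrow>\<^sub>E {1..}" and m: "(\<Sum>i\<in>I. replicate_mset (w i) (g i)) = m"
        by auto
      have "(\<Sum>j\<in>J. replicate_mset (w' j) (restrict (g \<circ> k) J j)) =
          (\<Sum>i\<in>I. replicate_mset (w i) (restrict (g \<circ> k) J (h i)))"
        by (rule mon)
      also have "\<dots> = (\<Sum>i\<in>I. replicate_mset (w i) (g i))"
        using img k by (intro sum.cong) auto
      finally show "restrict (g \<circ> k) J \<in>
          {g \<in> J \<rightarrow>\<^sub>E {1..}. (\<Sum>i\<in>J. replicate_mset (w' i) (g i)) = m}"
        using g hk by (simp add: m PiE_iff)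
    qed
  qed
  from bij_betw_same_card[OF this] show ?thesis
    unfolding family_count_def by (rule sym)
qed

lemma image_mset_nth_sorted_list:
  "image_mset (\<lambda>i. sorted_list_of_multiset \<mu> ! i) (mset_set {..<size \<mu>}) = \<mu>"
proof -
  let ?xs = "sorted_list_of_multiset \<mu>"
  have len: "length ?xs = size \<mu>" by (metis mset_sorted_list_of_multiset size_mset)
  have "image_mset ((!) ?xs) (mset_set {..<size \<mu>}) = mset (map ((!) ?xs) [0..<size \<mu>])"
    by (simp add: lessThan_atLeast0)
  also have "\<dots> = \<mu>" by (metis len map_nth mset_sorted_list_of_multiset)
  finally show ?thesis by simp
qed

text \<open>A product of power sums depends only on the multiset of its exponents. This allows
  products indexed by the components of a graph to be compared across different graphs.\<close>

lemma family_count_eq_power_sum: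
  assumes "finite I"
  shows "family_count I w m = power_sum (image_mset w (mset_set I)) m"
proof -
  define \<mu> where "\<mu> = image_mset w (mset_set I)"
  have "card {i \<in> I. w i = k} = card {j \<in> {..<size \<mu>}. sorted_list_of_multiset \<mu> ! j = k}" for k
  proof -
    have "card {i \<in> I. w i = k} = count \<mu> k"
      using assms by (simp add: \<mu>_def count_image_mset_set)
    also have "\<dots> = count (image_mset (\<lambda>i. sorted_list_of_multiset \<mu> ! i) (mset_set {..<size \<mu>})) k"
      by (simp only: image_mset_nth_sorted_list)
    also have "\<dots> = card {j \<in> {..<size \<mu>}. sorted_list_of_multiset \<mu> ! j = k}"
      by (rule count_image_mset_set) simp
    finally show ?thesis .
  qed
  then obtain h where "bij_betw h I {..<size \<mu>}"
    "\<And>i. i \<in> I \<Longrightarrow> sorted_list_of_multiset \<mu> ! h i = w i"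
    using ex_bij_betw_fibrewise[OF assms finite_lessThan,
      where w = w and w' = "(!) (sorted_list_of_multiset \<mu>)"] by blast
  then show ?thesis
    unfolding power_sum_def \<mu>_def[symmetric] by (rule family_count_cong_bij)
qed

section \<open>Triangularity of the power sums\<close>

text \<open>The monomial that arises in the product for \<open>\<mu>\<close> when the factors
  contribute pairwise different variables. It acts as the leading monomial; the shift by
  \<open>Suc\<close> is there because the variables start at index 1.\<close>

definition distinct_color_monomial :: "nat multiset \<Rightarrow> nat multiset" where
  "distinct_color_monomial \<mu> =
     (\<Sum>i<size \<mu>. replicate_mset (sorted_list_of_multiset \<mu> ! i) (Suc i))"

text \<open>A positive exponent forces the chosen color to occur in \<open>m\<close>. A factor with
  exponent 0 could take any color, and \<open>card\<close> of the resulting infinite set would be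
  0.\<close>

lemma finite_family_colorings:
  assumes "finite I" and "\<And>i. i \<in> I \<Longrightarrow> 0 < w i"
  shows "finite {g \<in> I \<rightarrow>\<^sub>E {1..}. (\<Sum>i\<in>I. replicate_mset (w i) (g i)) = m}"
proof (rule finite_subset)
  show "{g \<in> I \<rightarrow>\<^sub>E {1..}. (\<Sum>i\<in>I. replicate_mset (w i) (g i)) = m} \<subseteq> I \<rightarrow>\<^sub>E set_mset m"
  proof
    fix g assume "g \<in> {g \<in> I \<rightarrow>\<^sub>E {1..}. (\<Sum>i\<in>I. replicate_mset (w i) (g i)) = m}"
    then have g: "g \<in> extensional I" and m: "m = (\<Sum>i\<in>I. replicate_mset (w i) (g i))"
      by (auto simp: PiE_def)
    have "g i \<in># m" if "i \<in> I" for i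
      unfolding m using that assms by (force simp: set_mset_sum)
    then show "g \<in> I \<rightarrow>\<^sub>E set_mset m" using g by (simp add: PiE_iff)
  qed
  show "finite (I \<rightarrow>\<^sub>E set_mset m)" using assms by (intro finite_PiE) auto
qed

lemma nth_sorted_list_pos:
  fixes \<mu> :: "nat multiset"
  assumes "0 \<notin># \<mu>" "i < size \<mu>"
  shows "0 < sorted_list_of_multiset \<mu> ! i"
proof -
  have "length (sorted_list_of_multiset \<mu>) = size \<mu>"
    by (metis mset_sorted_list_of_multiset size_mset)
  then have "sorted_list_of_multiset \<mu> ! i \<in># \<mu>"
    using assms(2) by (metis nth_mem set_sorted_list_of_multiset)
  then show ?thesis using assms(1) by (metis gr0I)
qed

lemma power_sum_distinct_color_monomial_nonzero:
  assumes "0 \<notin># \<mu>"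
  shows "power_sum \<mu> (distinct_color_monomial \<mu>) \<noteq> 0"
proof -
  let ?A = "{g \<in> {..<size \<mu>} \<rightarrow>\<^sub>E {1..}.
    (\<Sum>i<size \<mu>. replicate_mset (sorted_list_of_multiset \<mu> ! i) (g i)) = distinct_color_monomial \<mu>}"
  have "finite ?A"
    using nth_sorted_list_pos[OF assms] by (intro finite_family_colorings) auto
  moreover have "restrict Suc {..<size \<mu>} \<in> ?A"
    by (auto simp: distinct_color_monomial_def)
  ultimately have "card ?A \<noteq> 0" using card_0_eq by blast
  then show ?thesis unfolding power_sum_def family_count_def .
qed

text \<open>The monomial has \<open>size \<mu>\<close> distinct variables, so a product producing it
  needs at least that many factors. With no more than that available, factors and variables
  correspond one to one and the exponents agree.\<close>

lemma power_sum_distinct_color_monomial_triangular: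
  assumes "0 \<notin># \<mu>" "0 \<notin># \<nu>" and nz: "power_sum \<nu> (distinct_color_monomial \<mu>) \<noteq> 0"
    and le: "size \<nu> \<le> size \<mu>"
  shows "\<nu> = \<mu>"
proof -
  let ?x = "\<lambda>i. sorted_list_of_multiset \<mu> ! i" and ?y = "\<lambda>i. sorted_list_of_multiset \<nu> ! i"
  obtain g where g: "(\<Sum>i<size \<nu>. replicate_mset (?y i) (g i)) = distinct_color_monomial \<mu>"
    using nz unfolding power_sum_def family_count_def by (auto simp: card_eq_0_iff)
  have "set_mset (\<Sum>i<size \<nu>. replicate_mset (?y i) (g i)) = g ` {..<size \<nu>}"
    using nth_sorted_list_pos[OF assms(2)] by (auto simp: set_mset_sum)
  moreover have "set_mset (distinct_color_monomial \<mu>) = Suc ` {..<size \<mu>}"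
    using nth_sorted_list_pos[OF assms(1)]
    by (auto simp: set_mset_sum distinct_color_monomial_def)
  ultimately have img: "g ` {..<size \<nu>} = Suc ` {..<size \<mu>}" using g by simp
  then have "size \<mu> \<le> size \<nu>"
    by (metis card_image card_image_le card_lessThan finite_lessThan inj_Suc)
  with le have sz: "size \<nu> = size \<mu>" by simp
  have "card (g ` {..<size \<nu>}) = card {..<size \<nu>}"
    unfolding img by (simp add: sz card_image)
  then have inj: "inj_on g {..<size \<nu>}" by (simp add: eq_card_imp_inj_on)
  \<comment> \<open>By injectivity, the variable \<open>g i\<close> receives its whole exponent from
    the single factor \<open>i\<close>.\<close>
  have y: "?y i = count (distinct_color_monomial \<mu>) (g i)" if "i < size \<nu>" for i
  proof -
    have "count (distinct_color_monomial \<mu>) (g i) = (\<Sum>j<size \<nu>. if g j = g i then ?y j else 0)"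
      unfolding g[symmetric] by (simp add: count_sum eq_commute)
    also have "\<dots> = (\<Sum>j<size \<nu>. if j = i then ?y j else 0)"
      using that inj by (intro sum.cong) (auto simp: inj_on_def)
    also have "\<dots> = ?y i" using that by simp
    finally show ?thesis by simp
  qed
  have x: "?x i = count (distinct_color_monomial \<mu>) (Suc i)" if "i < size \<mu>" for i
    using that by (simp add: distinct_color_monomial_def count_sum)
  have "\<nu> = image_mset ?y (mset_set {..<size \<nu>})"
    by (simp add: image_mset_nth_sorted_list)
  also have "\<dots> = image_mset (count (distinct_color_monomial \<mu>)) (image_mset g (mset_set {..<size \<nu>}))"
    using y by (auto simp: multiset.map_comp intro!: image_mset_cong)
  also have "image_mset g (mset_set {..<size \<nu>}) = image_mset Suc (mset_set {..<size \<mu>})"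
    using inj by (simp add: image_mset_mset_set img)
  also have "image_mset (count (distinct_color_monomial \<mu>)) \<dots> = image_mset ?x (mset_set {..<size \<mu>})"
    using x by (auto simp: multiset.map_comp intro!: image_mset_cong)
  also have "\<dots> = \<mu>" by (rule image_mset_nth_sorted_list)
  finally show ?thesis .
qed

text \<open>Among the partitions with nonzero coefficient, take one with the most parts. By
  triangularity no other term contributes to its \<open>distinct_color_monomial\<close>, so the
  combination cannot vanish there.\<close>

lemma power_sums_independent:
  fixes a :: "nat multiset \<Rightarrow> int"
  assumes "finite \<Lambda>" and "\<And>\<mu>. \<mu> \<in> \<Lambda> \<Longrightarrow> 0 \<notin># \<mu>"
    and zero: "\<And>m. (\<Sum>\<mu>\<in>\<Lambda>. a \<mu> * int (power_sum \<mu> m)) = 0"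
    and "\<mu> \<in> \<Lambda>"
  shows "a \<mu> = 0"
proof (rule ccontr)
  assume "a \<mu> \<noteq> 0"
  define N where "N = {\<mu> \<in> \<Lambda>. a \<mu> \<noteq> 0}"
  have "finite N" "N \<noteq> {}" using assms(1,4) \<open>a \<mu> \<noteq> 0\<close> by (auto simp: N_def)
  then have "Max (size ` N) \<in> size ` N" by simp
  then obtain \<nu> where \<nu>: "\<nu> \<in> N" and "size \<nu> = Max (size ` N)" by auto
  then have max: "size \<rho> \<le> size \<nu>" if "\<rho> \<in> N" for \<rho>
    using that \<open>finite N\<close> by simp
  let ?m = "distinct_color_monomial \<nu>"
  have "(\<Sum>\<rho>\<in>\<Lambda>. a \<rho> * int (power_sum \<rho> ?m)) = (\<Sum>\<rho>\<in>{\<nu>}. a \<rho> * int (power_sum \<rho> ?m))"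
  proof (rule sum.mono_neutral_right)
    show "\<forall>\<rho>\<in>\<Lambda> - {\<nu>}. a \<rho> * int (power_sum \<rho> ?m) = 0"
    proof
      fix \<rho> assume \<rho>: "\<rho> \<in> \<Lambda> - {\<nu>}"
      show "a \<rho> * int (power_sum \<rho> ?m) = 0"
      proof (cases "a \<rho> = 0")
        case False
        then have "size \<rho> \<le> size \<nu>" using \<rho> max by (auto simp: N_def)
        then have "power_sum \<rho> ?m = 0"
          using power_sum_distinct_color_monomial_triangular[of \<nu> \<rho>] \<rho> \<nu> assms(2)
          by (auto simp: N_def)
        then show ?thesis by simp
      qed simp
    qed
  qed (use \<nu> assms(1) in \<open>auto simp: N_def\<close>)
  then have "a \<nu> * int (power_sum \<nu> ?m) = 0" using zero by simp
  then show False
    using power_sum_distinct_color_monomial_nonzero[of \<nu>] \<nu> assms(2) by (auto simp: N_def)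
qed


section \<open>The power sum expansion of the chromatic symmetric function\<close>

definition const_on_edges :: "('a \<Rightarrow> nat) \<Rightarrow> 'a set set \<Rightarrow> bool" where
  "const_on_edges \<kappa> S \<longleftrightarrow> (\<forall>e\<in>S. \<forall>u\<in>e. \<forall>v\<in>e. \<kappa> u = \<kappa> v)"

text \<open>The connected components of the spanning subgraph with edge set \<open>S\<close>: two vertices lie in the
  same component iff no labelling that is constant along the edges of \<open>S\<close> separates them.\<close>

definition block :: "'a sgraph \<Rightarrow> 'a set set \<Rightarrow> 'a \<Rightarrow> 'a set" where
  "block G S v = {u \<in> gverts G. \<forall>\<kappa>. const_on_edges \<kappa> S \<longrightarrow> \<kappa> u = \<kappa> v}"

definition blocks :: "'a sgraph \<Rightarrow> 'a set set \<Rightarrow> 'a set set" where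
  "blocks G S = block G S ` gverts G"

definition block_type :: "'a sgraph \<Rightarrow> 'a set set \<Rightarrow> nat multiset" where
  "block_type G S = image_mset card (mset_set (blocks G S))"

text \<open>This is the coefficient of \<open>p\<^sub>\<mu>\<close> in the power sum expansion of \<open>X\<^sub>G\<close>.\<close>

definition type_coeff :: "'a sgraph \<Rightarrow> nat multiset \<Rightarrow> int" where
  "type_coeff G \<mu> = (\<Sum>S | S \<subseteq> gedges G \<and> block_type G S = \<mu>. (-1) ^ card S)"

lemma finite_gedges: "simple_graph G \<Longrightarrow> finite (gedges G)"
  by (rule finite_subset[of _ "Pow (gverts G)"]) (auto simp: simple_graph_def)

lemma self_in_block: "v \<in> gverts G \<Longrightarrow> v \<in> block G S v"
  by (simp add: block_def)

lemma block_eq_iff: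
  assumes "u \<in> gverts G" "v \<in> gverts G"
  shows "block G S u = block G S v \<longleftrightarrow> (\<forall>\<kappa>. const_on_edges \<kappa> S \<longrightarrow> \<kappa> u = \<kappa> v)"
proof
  assume "block G S u = block G S v"
  then have "u \<in> block G S v" using assms(1) by (auto simp: block_def)
  then show "\<forall>\<kappa>. const_on_edges \<kappa> S \<longrightarrow> \<kappa> u = \<kappa> v" by (simp add: block_def)
qed (auto simp: block_def)

lemma block_neqI:
  assumes "u \<in> gverts G" and "const_on_edges \<kappa> S" and "\<kappa> u \<noteq> \<kappa> v"
  shows "block G S u \<noteq> block G S v"
proof
  assume "block G S u = block G S v"
  then have "u \<in> block G S v" using self_in_block[OF assms(1)] by blast
  then show False using assms(2,3) by (simp add: block_def)
qed

lemma block_mono: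
  assumes "S \<subseteq> S'" shows "block G S v \<subseteq> block G S' v"
proof -
  have "const_on_edges \<kappa> S" if "const_on_edges \<kappa> S'" for \<kappa> :: "'a \<Rightarrow> nat"
    using that assms unfolding const_on_edges_def by blast
  then show ?thesis unfolding block_def by blast
qed

lemma block_eqI: "u \<in> block G S v \<Longrightarrow> block G S u = block G S v"
  by (auto simp: block_def)

lemma finite_blocks: "finite (gverts G) \<Longrightarrow> finite (blocks G S)"
  by (simp add: blocks_def)

lemma size_block_type: "size (block_type G S) = card (blocks G S)"
  by (simp add: block_type_def)

lemma zero_notin_block_type:
  assumes "finite (gverts G)" shows "0 \<notin># block_type G S"
proof
  assume "0 \<in># block_type G S"
  then obtain v where v: "v \<in> gverts G" "card (block G S v) = 0"
    using assms by (auto simp: block_type_def blocks_def)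
  moreover have "finite (block G S v)" using assms by (simp add: block_def)
  ultimately show False using self_in_block[of v G S] by auto
qed

text \<open>Sending each component of \<open>S\<close> to the component of \<open>S'\<close> that
  contains it is surjective. It identifies the components of \<open>u\<close> and \<open>v\<close>,
  hence is not injective.\<close>

lemma card_blocks_less:
  assumes fin: "finite (gverts G)" and "S \<subseteq> S'" and uv: "u \<in> gverts G" "v \<in> gverts G"
    and "block G S u \<noteq> block G S v" and "block G S' u = block G S' v"
  shows "card (blocks G S') < card (blocks G S)"
proof -
  \<comment> \<open>Any representative will do: a component of \<open>S\<close> lies inside one
    component of \<open>S'\<close>.\<close>
  define \<phi> where "\<phi> B = block G S' (SOME x. x \<in> B)" for B
  have \<phi>: "\<phi> (block G S x) = block G S' x" if "x \<in> gverts G" for x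
  proof -
    have "(SOME y. y \<in> block G S x) \<in> block G S x"
      using self_in_block[OF that] by (rule someI)
    then have "(SOME y. y \<in> block G S x) \<in> block G S' x"
      using block_mono[OF \<open>S \<subseteq> S'\<close>] by blast
    then show ?thesis unfolding \<phi>_def by (rule block_eqI)
  qed
  then have img: "\<phi> ` blocks G S = blocks G S'" by (auto simp: blocks_def image_image)
  have "\<not> inj_on \<phi> (blocks G S)"
    using \<phi>[OF uv(1)] \<phi>[OF uv(2)] uv assms(5,6) unfolding inj_on_def blocks_def by blast
  then have "card (\<phi> ` blocks G S) \<noteq> card (blocks G S)"
    using finite_blocks[OF fin] eq_card_imp_inj_on by blast
  then show ?thesis
    using card_image_le[OF finite_blocks[OF fin], of \<phi> S] img by simp
qed

text \<open>Once the components are recognized as the fibres of some \<open>h\<close>, their sizes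
  can be counted over the values of \<open>h\<close>. For caterpillars, \<open>h\<close> will be a
  position on the spine.\<close>

lemma block_type_of_fibres:
  assumes fin: "finite (gverts G)"
    and h: "\<And>u v. u \<in> gverts G \<Longrightarrow> v \<in> gverts G \<Longrightarrow> block G S u = block G S v \<longleftrightarrow> h u = h v"
  shows "block_type G S =
    image_mset (\<lambda>i. card {v \<in> gverts G. h v = i}) (mset_set (h ` gverts G))"
proof -
  have b: "block G S v = {u \<in> gverts G. h u = h v}" if "v \<in> gverts G" for v
  proof -
    have "u \<in> block G S v \<longleftrightarrow> u \<in> gverts G \<and> block G S u = block G S v" for u
      using self_in_block[of u G S] block_eqI[of u G S v] by (auto simp: block_def)
    then show ?thesis using h that by auto
  qed
  have "blocks G S = (\<lambda>i. {v \<in> gverts G. h v = i}) ` h ` gverts G"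
    using b by (auto simp: blocks_def image_image)
  moreover have "inj_on (\<lambda>i. {v \<in> gverts G. h v = i}) (h ` gverts G)"
    by (auto simp: inj_on_def)
  ultimately have "mset_set (blocks G S) =
      image_mset (\<lambda>i. {v \<in> gverts G. h v = i}) (mset_set (h ` gverts G))"
    by (simp add: image_mset_mset_set)
  then show ?thesis by (simp add: block_type_def multiset.map_comp comp_def)
qed

section \<open>Inclusion-exclusion over edge sets\<close>

lemma sum_singleton_mset: "(\<Sum>v\<in>A. {#c#}) = replicate_mset (card A) c"
  by (induction A rule: infinite_finite_induct) auto

text \<open>A coloring constant along \<open>S\<close> amounts to one color per component, and a
  component \<open>B\<close> of color \<open>c\<close> contributes the variable of index
  \<open>c\<close> to the power \<open>card B\<close>. Summing over all choices gives a product of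
  power sums.\<close>

lemma card_colorings_const_on_edges:
  assumes G: "simple_graph G" and S: "S \<subseteq> gedges G"
  shows "card {\<kappa> \<in> gverts G \<rightarrow>\<^sub>E {1..}. const_on_edges \<kappa> S \<and> color_monomial G \<kappa> = m} =
    power_sum (block_type G S) m"
proof -
  let ?V = "gverts G" and ?b = "block G S"
  have fin: "finite ?V" using G by (simp add: simple_graph_def)
  have mon: "(\<Sum>v\<in>?V. {#g (?b v)#}) = (\<Sum>B\<in>blocks G S. replicate_mset (card B) (g B))"
    for g :: "'a set \<Rightarrow> nat"
  proof -
    have "(\<Sum>v\<in>?V. {#g (?b v)#}) = (\<Sum>B\<in>?b ` ?V. \<Sum>v\<in>{v. v \<in> ?V \<and> ?b v = B}. {#g (?b v)#})"
      using fin by (rule sum.image_gen)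
    also have "\<dots> = (\<Sum>B\<in>?b ` ?V. replicate_mset (card B) (g B))"
    proof (rule sum.cong)
      fix B assume "B \<in> ?b ` ?V"
      then obtain v where v: "v \<in> ?V" "B = ?b v" by blast
      have "{v. v \<in> ?V \<and> ?b v = B} = B"
        unfolding v(2) using self_in_block[of _ G S] block_eqI[of _ G S v]
        by (auto simp: block_def)
      moreover have "(\<Sum>v\<in>{v. v \<in> ?V \<and> ?b v = B}. {#g (?b v)#}) =
          (\<Sum>v\<in>{v. v \<in> ?V \<and> ?b v = B}. {#g B#})"
        by (rule sum.cong) auto
      ultimately show "(\<Sum>v\<in>{v. v \<in> ?V \<and> ?b v = B}. {#g (?b v)#}) = replicate_mset (card B) (g B)"
        by (simp add: sum_singleton_mset)
    qed simp
    finally show ?thesis by (simp add: blocks_def)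
  qed
  let ?A = "{g \<in> blocks G S \<rightarrow>\<^sub>E {1..}. (\<Sum>B\<in>blocks G S. replicate_mset (card B) (g B)) = m}"
  let ?K = "{\<kappa> \<in> ?V \<rightarrow>\<^sub>E {1..}. const_on_edges \<kappa> S \<and> color_monomial G \<kappa> = m}"
  let ?f = "\<lambda>g. restrict (\<lambda>v. g (?b v)) ?V"
  have cm: "color_monomial G (?f g) = (\<Sum>B\<in>blocks G S. replicate_mset (card B) (g B))" for g
    unfolding color_monomial_def mon[symmetric] by (rule sum.cong) auto
  have "inj_on ?f ?A"
  proof (rule inj_onI)
    fix g g' assume g: "g \<in> ?A" "g' \<in> ?A" "?f g = ?f g'"
    show "g = g'"
    proof (rule PiE_ext)
      show "g \<in> blocks G S \<rightarrow>\<^sub>E {1..}" "g' \<in> blocks G S \<rightarrow>\<^sub>E {1..}" using g by auto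
      fix B assume "B \<in> blocks G S"
      then obtain v where "v \<in> ?V" "B = ?b v" by (auto simp: blocks_def)
      then show "g B = g' B" using fun_cong[OF g(3), of v] by simp
    qed
  qed
  moreover have "?f ` ?A = ?K"
  proof
    show "?f ` ?A \<subseteq> ?K"
    proof (rule image_subsetI)
      fix g assume g: "g \<in> ?A"
      have "const_on_edges (?f g) S"
        unfolding const_on_edges_def
      proof (intro ballI)
        fix e u v assume e: "e \<in> S" "u \<in> e" "v \<in> e"
        then have uv: "u \<in> ?V" "v \<in> ?V" using S G by (auto simp: simple_graph_def)
        then have "?b u = ?b v"
          using e unfolding block_eq_iff[OF uv] const_on_edges_def by blast
        then show "?f g u = ?f g v" using uv by simp
      qed
      moreover have "color_monomial G (?f g) = m" unfolding cm using g by simp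
      moreover have "?f g \<in> ?V \<rightarrow>\<^sub>E {1..}" using g by (auto simp: blocks_def)
      ultimately show "?f g \<in> ?K" by simp
    qed
    show "?K \<subseteq> ?f ` ?A"
    proof
      fix \<kappa> assume \<kappa>: "\<kappa> \<in> ?K"
      \<comment> \<open>The color of a component is read off at an arbitrary vertex of it, since
        \<open>\<kappa>\<close> is constant there.\<close>
      define g where "g = restrict (\<lambda>B. \<kappa> (SOME v. v \<in> B)) (blocks G S)"
      have gb: "g (?b v) = \<kappa> v" if v: "v \<in> ?V" for v
      proof -
        have "(SOME w. w \<in> ?b v) \<in> ?b v" using self_in_block[OF v] by (rule someI)
        then have "\<kappa> (SOME w. w \<in> ?b v) = \<kappa> v" using \<kappa> by (auto simp: block_def)
        then show ?thesis using v by (simp add: g_def blocks_def)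
      qed
      have "?f g v = \<kappa> v" for v
        using \<kappa> gb[of v] by (cases "v \<in> ?V") (auto simp: PiE_def extensional_def)
      then have f: "?f g = \<kappa>" by (rule ext)
      have "g \<in> blocks G S \<rightarrow>\<^sub>E {1..}"
      proof (rule PiE_I)
        fix B assume "B \<in> blocks G S"
        then obtain v where "v \<in> ?V" "B = ?b v" by (auto simp: blocks_def)
        then show "g B \<in> {1..}" using gb \<kappa> by auto
      qed (simp add: g_def)
      moreover have "(\<Sum>B\<in>blocks G S. replicate_mset (card B) (g B)) = m"
        using cm[of g] f \<kappa> by simp
      ultimately have "g \<in> ?A" by simp
      then show "\<kappa> \<in> ?f ` ?A" using f by (metis (no_types, lifting) image_eqI)
    qed
  qed
  ultimately have "bij_betw ?f ?A ?K" unfolding bij_betw_def by blast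
  from bij_betw_same_card[OF this] have "card ?K = family_count (blocks G S) card m"
    unfolding family_count_def by (rule sym)
  also have "\<dots> = power_sum (block_type G S) m"
    unfolding block_type_def using finite_blocks[OF fin] by (rule family_count_eq_power_sum)
  finally show ?thesis .
qed

text \<open>This is the expansion of the product of \<open>-1 + 1\<close> over the elements of
  \<open>M\<close>.\<close>

lemma sum_Pow_neg_one_power_card:
  assumes "finite M"
  shows "(\<Sum>S\<in>Pow M. (-1) ^ card S) = (if M = {} then 1 else 0 :: int)"
  using prod_add[OF assms, of "\<lambda>_. -1 :: int" "\<lambda>_. 1"] assms
  by (simp add: card_gt_0_iff power_0_left)

text \<open>For a fixed coloring, the signs summed over all sets of monochromatic edges give 1 if
  there is no such edge, that is, if the coloring is proper, and 0 otherwise. Exchanging the sums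
  leaves, for each \<open>S\<close>, the colorings constant along \<open>S\<close>.\<close>

lemma chromatic_sym_power_sum_expansion:
  assumes G: "simple_graph G"
  shows "chromatic_sym G m =
    (\<Sum>S\<in>Pow (gedges G). (-1) ^ card S * int (power_sum (block_type G S) m))"
proof -
  let ?V = "gverts G" and ?E = "gedges G"
  let ?K = "{\<kappa> \<in> ?V \<rightarrow>\<^sub>E {1..}. color_monomial G \<kappa> = m}"
  have fin: "finite ?V" and finE: "finite ?E"
    using G finite_gedges by (auto simp: simple_graph_def)
  have finK: "finite ?K"
  proof (rule finite_subset)
    show "?K \<subseteq> ?V \<rightarrow>\<^sub>E set_mset m"
      using fin
      by (auto simp: color_monomial_def set_mset_sum PiE_iff extensional_def)
    show "finite (?V \<rightarrow>\<^sub>E set_mset m)" using fin by (intro finite_PiE) auto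
  qed
  have proper: "\<kappa> \<in> proper_colorings G \<longleftrightarrow> {e \<in> ?E. const_on_edges \<kappa> {e}} = {}"
    if "\<kappa> \<in> ?K" for \<kappa>
  proof -
    have "{e \<in> ?E. const_on_edges \<kappa> {e}} = {} \<longleftrightarrow> (\<forall>u\<in>?V. \<forall>v\<in>?V. gadj G u v \<longrightarrow> \<kappa> u \<noteq> \<kappa> v)"
    proof
      assume L: "{e \<in> ?E. const_on_edges \<kappa> {e}} = {}"
      show "\<forall>u\<in>?V. \<forall>v\<in>?V. gadj G u v \<longrightarrow> \<kappa> u \<noteq> \<kappa> v"
      proof (intro ballI impI notI)
        fix u v assume "gadj G u v" "\<kappa> u = \<kappa> v"
        then have "{u, v} \<in> {e \<in> ?E. const_on_edges \<kappa> {e}}"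
          by (auto simp: gadj_def const_on_edges_def)
        then show False using L by blast
      qed
    next
      assume R: "\<forall>u\<in>?V. \<forall>v\<in>?V. gadj G u v \<longrightarrow> \<kappa> u \<noteq> \<kappa> v"
      have "\<not> const_on_edges \<kappa> {e}" if "e \<in> ?E" for e
      proof -
        have "e \<subseteq> ?V" "card e = 2" using that G by (auto simp: simple_graph_def)
        then obtain u v where "e = {u, v}" "u \<in> ?V" "v \<in> ?V"
          by (auto simp: card_2_iff)
        then show ?thesis using R that by (auto simp: gadj_def const_on_edges_def)
      qed
      then show "{e \<in> ?E. const_on_edges \<kappa> {e}} = {}" by blast
    qed
    then show ?thesis using that by (simp add: proper_colorings_def)
  qed
  have "{\<kappa> \<in> proper_colorings G. color_monomial G \<kappa> = m} = {\<kappa> \<in> ?K. \<kappa> \<in> proper_colorings G}"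
    by (auto simp: proper_colorings_def)
  then have "chromatic_sym G m = (\<Sum>\<kappa>\<in>?K. if \<kappa> \<in> proper_colorings G then 1 else 0)"
    using finK by (simp only: chromatic_sym_def sum.inter_filter[symmetric]) simp
  also have "\<dots> = (\<Sum>\<kappa>\<in>?K. \<Sum>S\<in>Pow ?E. if const_on_edges \<kappa> S then (-1) ^ card S else 0)"
  proof (rule sum.cong)
    fix \<kappa> assume \<kappa>: "\<kappa> \<in> ?K"
    let ?M = "{e \<in> ?E. const_on_edges \<kappa> {e}}"
    have "const_on_edges \<kappa> S \<longleftrightarrow> (\<forall>e\<in>S. const_on_edges \<kappa> {e})" for S
      by (simp add: const_on_edges_def)
    then have "{S \<in> Pow ?E. const_on_edges \<kappa> S} = Pow ?M" by blast
    then have "(\<Sum>S\<in>Pow ?E. if const_on_edges \<kappa> S then (-1) ^ card S else 0) =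
        (\<Sum>S\<in>Pow ?M. (-1) ^ card S :: int)"
      using finE by (simp add: sum.inter_filter[symmetric])
    then show "(if \<kappa> \<in> proper_colorings G then 1 else 0 :: int) =
        (\<Sum>S\<in>Pow ?E. if const_on_edges \<kappa> S then (-1) ^ card S else 0)"
      using proper[OF \<kappa>] finE by (simp add: sum_Pow_neg_one_power_card)
  qed simp
  also have "\<dots> = (\<Sum>S\<in>Pow ?E. \<Sum>\<kappa>\<in>?K. if const_on_edges \<kappa> S then (-1) ^ card S else 0)"
    by (rule sum.swap)
  also have "\<dots> = (\<Sum>S\<in>Pow ?E. (-1) ^ card S * int (power_sum (block_type G S) m))"
  proof (rule sum.cong)
    fix S assume S: "S \<in> Pow ?E"
    have "(\<Sum>\<kappa>\<in>?K. if const_on_edges \<kappa> S then (-1) ^ card S else 0 :: int) =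
        (\<Sum>\<kappa>\<in>{\<kappa> \<in> ?K. const_on_edges \<kappa> S}. (-1) ^ card S)"
      using finK by (simp only: sum.inter_filter)
    also have "\<dots> = (-1) ^ card S * int (card {\<kappa> \<in> ?K. const_on_edges \<kappa> S})"
      by simp
    also have "{\<kappa> \<in> ?K. const_on_edges \<kappa> S} =
        {\<kappa> \<in> ?V \<rightarrow>\<^sub>E {1..}. const_on_edges \<kappa> S \<and> color_monomial G \<kappa> = m}"
      by auto
    finally show "(\<Sum>\<kappa>\<in>?K. if const_on_edges \<kappa> S then (-1) ^ card S else 0 :: int) =
        (-1) ^ card S * int (power_sum (block_type G S) m)"
      using card_colorings_const_on_edges[OF G, of S m] S by simp
  qed simp
  finally show ?thesis .
qed

text \<open>Edge sets are grouped by type. The index set may be larger than the set of types that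
  occur, so that two graphs can be expanded over a common one.\<close>

lemma chromatic_sym_type_coeff_expansion:
  assumes G: "simple_graph G" and "finite \<Lambda>" "block_type G ` Pow (gedges G) \<subseteq> \<Lambda>"
  shows "chromatic_sym G m = (\<Sum>\<nu>\<in>\<Lambda>. type_coeff G \<nu> * int (power_sum \<nu> m))"
proof -
  have fin: "finite (Pow (gedges G))" using G by (simp add: finite_gedges)
  have "(\<Sum>\<nu>\<in>\<Lambda>. type_coeff G \<nu> * int (power_sum \<nu> m)) =
      (\<Sum>\<nu>\<in>\<Lambda>. \<Sum>S | S \<in> Pow (gedges G) \<and> block_type G S = \<nu>.
        (-1) ^ card S * int (power_sum (block_type G S) m))"
    by (auto simp: type_coeff_def sum_distrib_right intro!: sum.cong)
  also have "\<dots> = (\<Sum>S\<in>Pow (gedges G). (-1) ^ card S * int (power_sum (block_type G S) m))"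
    using fin assms(2,3) by (rule sum.group)
  finally show ?thesis using chromatic_sym_power_sum_expansion[OF G] by simp
qed

lemma type_coeff_zero_part:
  assumes "simple_graph G" and "0 \<in># \<mu>"
  shows "type_coeff G \<mu> = 0"
proof -
  have empty: "{S. S \<subseteq> gedges G \<and> block_type G S = \<mu>} = {}"
    using zero_notin_block_type[of G] assms by (auto simp: simple_graph_def)
  show ?thesis unfolding type_coeff_def empty by simp
qed

text \<open>Independence applies to the difference of the two expansions. It covers only partitions
  without part 0; for the others both coefficients vanish because components are nonempty.\<close>

lemma type_coeff_eq_if_chromatic_sym_eq:
  fixes G :: "'a sgraph" and H :: "'b sgraph"
  assumes G: "simple_graph G" and H: "simple_graph H" and eq: "chromatic_sym G = chromatic_sym H"
  shows "type_coeff G \<mu> = type_coeff H \<mu>"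
proof (cases "0 \<in># \<mu>")
  case True
  then show ?thesis using G H by (simp add: type_coeff_zero_part)
next
  case False
  \<comment> \<open>Inserting \<open>\<mu>\<close> covers the case that no edge set of either graph
    has this type.\<close>
  define \<Lambda> where "\<Lambda> = insert \<mu> (block_type G ` Pow (gedges G) \<union> block_type H ` Pow (gedges H))"
  have fin: "finite \<Lambda>" using G H by (simp add: \<Lambda>_def finite_gedges)
  have "type_coeff G \<mu> - type_coeff H \<mu> = 0"
  proof (rule power_sums_independent[OF fin])
    show "0 \<notin># \<nu>" if "\<nu> \<in> \<Lambda>" for \<nu>
      using that False zero_notin_block_type[of G] zero_notin_block_type[of H] G H
      by (auto simp: \<Lambda>_def simple_graph_def)
    have sub: "block_type G ` Pow (gedges G) \<subseteq> \<Lambda>" "block_type H ` Pow (gedges H) \<subseteq> \<Lambda>"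
      by (auto simp: \<Lambda>_def)
    show "(\<Sum>\<nu>\<in>\<Lambda>. (type_coeff G \<nu> - type_coeff H \<nu>) * int (power_sum \<nu> m)) = 0" for m
      using chromatic_sym_type_coeff_expansion[OF G fin sub(1), of m]
        chromatic_sym_type_coeff_expansion[OF H fin sub(2), of m] eq
      by (simp add: left_diff_distrib sum_subtractf)
  qed (simp add: \<Lambda>_def)
  then show ?thesis by simp
qed


section \<open>Component types in caterpillars\<close>

text \<open>\<open>idx v\<close> is the position on the spine of \<open>v\<close> itself, or of the neighbour of \<open>v\<close> if \<open>v\<close> is a leaf.\<close>

locale indexed_caterpillar =
  fixes T :: "'a sgraph" and vs :: "'a list" and idx :: "'a \<Rightarrow> nat"
  assumes simple: "simple_graph T"
    and dist: "distinct vs" and spine_verts: "set vs \<subseteq> gverts T"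
    and idx_less: "v \<in> gverts T \<Longrightarrow> idx v < length vs"
    and idx_nth: "i < length vs \<Longrightarrow> idx (vs ! i) = i"
    and edges: "gedges T = {{vs ! i, vs ! Suc i} | i. Suc i < length vs} \<union>
      {{u, vs ! idx u} | u. u \<in> gverts T - set vs}"
    and fibre_ge_2: "i < length vs \<Longrightarrow> 2 \<le> card {v \<in> gverts T. idx v = i}"
begin

definition leaf_edges :: "'a set set" where
  "leaf_edges = {{u, vs ! idx u} | u. u \<in> gverts T - set vs}"

text \<open>The size of the star formed by the \<open>i\<close>-th spine vertex and its leaves, so
  the leaf number plus one.\<close>

definition weight :: "nat \<Rightarrow> nat" where
  "weight i = card {v \<in> gverts T. idx v = i}"

lemma finite_verts: "finite (gverts T)"
  using simple by (simp add: simple_graph_def)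

lemma finite_edges: "finite (gedges T)"
  using simple by (rule finite_gedges)

lemma nth_vert: "i < length vs \<Longrightarrow> vs ! i \<in> gverts T"
  using spine_verts by auto

lemma nth_idx: "v \<in> set vs \<Longrightarrow> vs ! idx v = v"
  using idx_nth by (auto simp: in_set_conv_nth)

lemma leaf_edges_subset: "leaf_edges \<subseteq> gedges T"
  by (auto simp: edges leaf_edges_def)

lemma spine_edge_notin_leaf_edges:
  assumes "Suc j < length vs" shows "{vs ! j, vs ! Suc j} \<notin> leaf_edges"
proof
  assume "{vs ! j, vs ! Suc j} \<in> leaf_edges"
  then obtain u where "u \<notin> set vs" "u \<in> {vs ! j, vs ! Suc j}" by (auto simp: leaf_edges_def)
  then show False using assms by auto
qed

lemma edge_cases:
  assumes "e \<in> gedges T"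
  obtains (spine) i where "Suc i < length vs" "e = {vs ! i, vs ! Suc i}"
    | (leaf) u where "u \<in> gverts T" "u \<notin> set vs" "e = {u, vs ! idx u}"
  using assms unfolding edges by blast

text \<open>Adjacency is expressed through spine membership and position alone, so a bijection
  respecting these two data can be checked to be an isomorphism by arithmetic on positions.\<close>

lemma gadj_iff:
  assumes "u \<in> gverts T" "v \<in> gverts T"
  shows "gadj T u v \<longleftrightarrow>
    (if u \<in> set vs \<longleftrightarrow> v \<in> set vs
     then u \<in> set vs \<and> (idx v = Suc (idx u) \<or> idx u = Suc (idx v))
     else idx u = idx v)" (is "_ \<longleftrightarrow> ?R")
proof
  assume "gadj T u v"
  then show ?R
    unfolding gadj_def
  proof (cases rule: edge_cases)
    case (spine i)
    then show ?thesis using idx_nth[of i] idx_nth[of "Suc i"] by (auto simp: doubleton_eq_iff)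
  next
    case (leaf w)
    then have "vs ! idx w \<in> set vs" "idx (vs ! idx w) = idx w"
      using idx_less[of w] idx_nth[of "idx w"] by auto
    then show ?thesis using leaf by (auto simp: doubleton_eq_iff)
  qed
next
  assume R: ?R
  have spine: "{x, y} \<in> gedges T" if "x \<in> set vs" "y \<in> set vs" "idx y = Suc (idx x)" for x y
  proof -
    have "vs ! idx x = x" "vs ! Suc (idx x) = y" and len: "Suc (idx x) < length vs"
      using that nth_idx[of x] nth_idx[of y] idx_less[of y] spine_verts by auto
    moreover have "{vs ! idx x, vs ! Suc (idx x)} \<in> gedges T"
      unfolding edges using len by blast
    ultimately show ?thesis by simp
  qed
  have leaf: "{x, y} \<in> gedges T" if "x \<in> gverts T" "x \<notin> set vs" "y \<in> set vs" "idx x = idx y" for x y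
  proof -
    have "{x, vs ! idx x} \<in> gedges T" unfolding edges using that by blast
    then show ?thesis using that nth_idx[of y] by simp
  qed
  show "gadj T u v"
    using R spine[of u v] spine[of v u] leaf[of u v] leaf[of v u] assms
    by (auto simp: gadj_def insert_commute split: if_splits)
qed

lemma const_on_leaf_edges_iff:
  "const_on_edges \<kappa> leaf_edges \<longleftrightarrow> (\<forall>u \<in> gverts T - set vs. \<kappa> u = \<kappa> (vs ! idx u))"
proof -
  have "leaf_edges = (\<lambda>u. {u, vs ! idx u}) ` (gverts T - set vs)"
    by (auto simp: leaf_edges_def)
  then show ?thesis by (auto simp: const_on_edges_def)
qed

text \<open>A leaf whose edge is missing from \<open>S\<close> is an isolated component.\<close>

lemma leaf_edges_subset_if_one_notin_block_type:
  assumes S: "S \<subseteq> gedges T" and one: "1 \<notin># block_type T S"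
  shows "leaf_edges \<subseteq> S"
proof (rule ccontr)
  assume "\<not> leaf_edges \<subseteq> S"
  then obtain u where u: "u \<in> gverts T" "u \<notin> set vs" "{u, vs ! idx u} \<notin> S"
    by (auto simp: leaf_edges_def)
  have "u \<notin> e" if e: "e \<in> S" for e
  proof
    assume ue: "u \<in> e"
    have "e \<in> gedges T" using e S by blast
    then show False
    proof (cases rule: edge_cases)
      case (spine i)
      then show False using ue u by auto
    next
      case (leaf w)
      then have "u = w" using ue u idx_less[of w] by auto
      then show False using leaf e u by simp
    qed
  qed
  \<comment> \<open>No edge of \<open>S\<close> contains \<open>u\<close>, so the indicator of
    \<open>u\<close> is an admissible labelling and separates it from every other vertex.\<close>
  then have c: "const_on_edges (\<lambda>x. if x = u then 1 else 0) S"
    by (auto simp: const_on_edges_def)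
  have "block T S u \<subseteq> {u}"
  proof
    fix x assume "x \<in> block T S u"
    then have "(if x = u then 1 else 0 :: nat) = (if u = u then 1 else 0)"
      using c unfolding block_def by blast
    then show "x \<in> {u}" by (simp split: if_splits)
  qed
  then have "block T S u = {u}" using self_in_block[OF u(1), of S] by blast
  then have "{u} \<in> blocks T S" using u(1) by (auto simp: blocks_def)
  then have "card {u} \<in># block_type T S"
    unfolding block_type_def using finite_blocks[OF finite_verts] by force
  then show False using one by simp
qed

text \<open>An edge of \<open>S'\<close> missing from \<open>S\<close> cannot be a leaf edge, so it
  is a spine edge. Its ends lie in different components of \<open>S\<close>, and adding it merges
  them.\<close>

lemma card_blocks_strict_antimono:
  assumes L: "leaf_edges \<subseteq> S" and "S \<subset> S'" and S': "S' \<subseteq> gedges T"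
  shows "card (blocks T S') < card (blocks T S)"
proof -
  obtain e where e: "e \<in> S'" "e \<notin> S" using assms by blast
  then have "e \<in> gedges T" "e \<notin> leaf_edges" using S' L by auto
  then obtain k where k: "Suc k < length vs" "e = {vs ! k, vs ! Suc k}"
    by (cases rule: edge_cases) (auto simp: leaf_edges_def)
  have verts: "vs ! k \<in> gverts T" "vs ! Suc k \<in> gverts T" using k nth_vert by auto
  \<comment> \<open>This labelling cuts the spine after position \<open>k\<close>. Only the spine
    edge at \<open>k\<close> crosses the cut, and it is not in \<open>S\<close>.\<close>
  let ?\<kappa> = "\<lambda>v. if idx v \<le> k then 0 else 1 :: nat"
  have "const_on_edges ?\<kappa> S"
    unfolding const_on_edges_def
  proof
    fix f assume f: "f \<in> S"
    then have "f \<in> gedges T" using assms(2) S' by blast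
    then show "\<forall>u\<in>f. \<forall>v\<in>f. ?\<kappa> u = ?\<kappa> v"
    proof (cases rule: edge_cases)
      case (spine i)
      then have "i \<noteq> k" using f e(2) k(2) by auto
      then show ?thesis using spine(1) by (simp add: spine(2) idx_nth)
    next
      case (leaf w)
      then have "idx (vs ! idx w) = idx w" using idx_nth idx_less by simp
      then show ?thesis by (simp add: leaf(3))
    qed
  qed
  moreover have "?\<kappa> (vs ! k) \<noteq> ?\<kappa> (vs ! Suc k)" using k(1) by (simp add: idx_nth)
  ultimately have "block T S (vs ! k) \<noteq> block T S (vs ! Suc k)"
    by (rule block_neqI[OF verts(1)])
  moreover have "block T S' (vs ! k) = block T S' (vs ! Suc k)"
    unfolding block_eq_iff[OF verts]
  proof (intro allI impI)
    fix \<kappa> :: "'a \<Rightarrow> nat" assume "const_on_edges \<kappa> S'"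
    moreover have "vs ! k \<in> e" "vs ! Suc k \<in> e" by (simp_all add: k(2))
    ultimately show "\<kappa> (vs ! k) = \<kappa> (vs ! Suc k)"
      using e(1) unfolding const_on_edges_def by blast
  qed
  moreover have "S \<subseteq> S'" using assms(2) by blast
  ultimately show ?thesis by (intro card_blocks_less[OF finite_verts _ verts])
qed

section \<open>Types of the leaf edges, alone and with one spine edge\<close>

lemma idx_image: "idx ` gverts T = {..<length vs}"
proof
  show "{..<length vs} \<subseteq> idx ` gverts T"
  proof
    fix i assume "i \<in> {..<length vs}"
    then show "i \<in> idx ` gverts T"
      using nth_vert[of i] idx_nth[of i] by (metis image_eqI lessThan_iff)
  qed
qed (use idx_less in auto)

text \<open>The components are the stars around the spine vertices: \<open>idx\<close> is constant
  along leaf edges, and every labelling that is so depends only on \<open>idx\<close>.\<close>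

lemma block_type_leaf_edges:
  "block_type T leaf_edges = image_mset weight (mset_set {..<length vs})"
proof -
  have "block T leaf_edges u = block T leaf_edges v \<longleftrightarrow> idx u = idx v"
    if uv: "u \<in> gverts T" "v \<in> gverts T" for u v
    unfolding block_eq_iff[OF uv]
  proof
    assume R: "\<forall>\<kappa>. const_on_edges \<kappa> leaf_edges \<longrightarrow> \<kappa> u = \<kappa> v"
    have "const_on_edges idx leaf_edges"
      unfolding const_on_leaf_edges_iff using idx_nth idx_less by simp
    then show "idx u = idx v" using R by blast
  next
    assume eq: "idx u = idx v"
    show "\<forall>\<kappa>. const_on_edges \<kappa> leaf_edges \<longrightarrow> \<kappa> u = \<kappa> v"
    proof (intro allI impI)
      fix \<kappa> :: "'a \<Rightarrow> nat" assume "const_on_edges \<kappa> leaf_edges"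
      then have "\<kappa> x = \<kappa> (vs ! idx x)" if "x \<in> gverts T" for x
        using that nth_idx[of x] unfolding const_on_leaf_edges_iff by (cases "x \<in> set vs") auto
      then show "\<kappa> u = \<kappa> v" using uv eq by metis
    qed
  qed
  from block_type_of_fibres[OF finite_verts this] show ?thesis
    by (simp add: idx_image weight_def[abs_def])
qed

text \<open>The new edge joins the stars at \<open>j\<close> and \<open>Suc j\<close>. Adding the
  two old parts on the left avoids subtraction of multisets.\<close>

lemma block_type_insert_spine_edge:
  assumes j: "Suc j < length vs"
  shows "block_type T (insert {vs ! j, vs ! Suc j} leaf_edges) + {#weight j, weight (Suc j)#} =
    add_mset (weight j + weight (Suc j)) (block_type T leaf_edges)"
proof -
  let ?S = "insert {vs ! j, vs ! Suc j} leaf_edges"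
  \<comment> \<open>Position \<open>Suc j\<close> is collapsed to \<open>j\<close>, so the fibres of
    \<open>h\<close> are the stars after merging.\<close>
  define h where "h v = (if idx v = Suc j then j else idx v)" for v
  have const: "const_on_edges \<kappa> ?S \<longleftrightarrow>
      const_on_edges \<kappa> leaf_edges \<and> \<kappa> (vs ! j) = \<kappa> (vs ! Suc j)" for \<kappa>
    by (auto simp: const_on_edges_def)
  have "block T ?S u = block T ?S v \<longleftrightarrow> h u = h v"
    if uv: "u \<in> gverts T" "v \<in> gverts T" for u v
    unfolding block_eq_iff[OF uv]
  proof
    assume R: "\<forall>\<kappa>. const_on_edges \<kappa> ?S \<longrightarrow> \<kappa> u = \<kappa> v"
    have "const_on_edges h ?S"
      unfolding const const_on_leaf_edges_iff using idx_nth idx_less j by (simp add: h_def)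
    then show "h u = h v" using R by blast
  next
    assume eq: "h u = h v"
    show "\<forall>\<kappa>. const_on_edges \<kappa> ?S \<longrightarrow> \<kappa> u = \<kappa> v"
    proof (intro allI impI)
      fix \<kappa> :: "'a \<Rightarrow> nat" assume \<kappa>: "const_on_edges \<kappa> ?S"
      have "\<kappa> x = \<kappa> (vs ! h x)" if "x \<in> gverts T" for x
      proof -
        have "\<kappa> x = \<kappa> (vs ! idx x)"
          using \<kappa> that nth_idx[of x] unfolding const const_on_leaf_edges_iff
          by (cases "x \<in> set vs") auto
        then show ?thesis using \<kappa> unfolding const by (auto simp: h_def)
      qed
      then show "\<kappa> u = \<kappa> v" using uv eq by metis
    qed
  qed
  from block_type_of_fibres[OF finite_verts this]
  have bt: "block_type T ?S =
    image_mset (\<lambda>i. card {v \<in> gverts T. h v = i}) (mset_set (h ` gverts T))" .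
  have "h ` gverts T = (\<lambda>i. if i = Suc j then j else i) ` idx ` gverts T"
    unfolding h_def image_image by (rule refl)
  also have "\<dots> = insert j ({..<length vs} - {j, Suc j})"
    unfolding idx_image using j by (auto simp: image_iff)
  finally have img: "h ` gverts T = insert j ({..<length vs} - {j, Suc j})" .
  have "{v \<in> gverts T. h v = j} = {v \<in> gverts T. idx v = j} \<union> {v \<in> gverts T. idx v = Suc j}"
    by (auto simp: h_def)
  then have wj: "card {v \<in> gverts T. h v = j} = weight j + weight (Suc j)"
    unfolding weight_def using finite_verts by (simp add: card_Un_disjoint disjoint_iff)
  have wi: "card {v \<in> gverts T. h v = i} = weight i" if "i \<in> {..<length vs} - {j, Suc j}" for i
    unfolding weight_def using that by (intro arg_cong[where f = card]) (auto simp: h_def)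
  have "block_type T ?S =
      add_mset (weight j + weight (Suc j)) (image_mset weight (mset_set ({..<length vs} - {j, Suc j})))"
    unfolding bt img using wi wj by (auto intro!: image_mset_cong)
  moreover have "mset_set {..<length vs} =
      add_mset j (add_mset (Suc j) (mset_set ({..<length vs} - {j, Suc j})))"
  proof -
    define R where "R = {..<length vs} - {j, Suc j}"
    have "{..<length vs} = insert j (insert (Suc j) R)" using j by (auto simp: R_def)
    moreover have "finite R" "j \<notin> R" "Suc j \<notin> R" by (auto simp: R_def)
    ultimately show ?thesis unfolding R_def[symmetric] by simp
  qed
  ultimately show ?thesis by (simp add: block_type_leaf_edges)
qed

lemma weight_ge_2: "i < length vs \<Longrightarrow> 2 \<le> weight i"
  unfolding weight_def by (rule fibre_ge_2)

lemma size_block_type_leaf_edges: "size (block_type T leaf_edges) = length vs"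
  by (simp add: block_type_leaf_edges)

lemma size_block_type_insert_spine_edge:
  assumes "Suc j < length vs"
  shows "Suc (size (block_type T (insert {vs ! j, vs ! Suc j} leaf_edges))) = length vs"
  using arg_cong[OF block_type_insert_spine_edge[OF assms], of size]
  by (simp add: size_block_type_leaf_edges)

lemma one_notin_block_type_leaf_edges: "1 \<notin># block_type T leaf_edges"
proof
  assume "1 \<in># block_type T leaf_edges"
  then obtain i where "i < length vs" "weight i = 1" by (auto simp: block_type_leaf_edges)
  then show False using weight_ge_2[of i] by simp
qed

lemma one_notin_block_type_insert_spine_edge:
  assumes "Suc j < length vs"
  shows "1 \<notin># block_type T (insert {vs ! j, vs ! Suc j} leaf_edges)"
proof -
  have "1 \<noteq> weight j + weight (Suc j)" using weight_ge_2[of j] assms by simp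
  then have "1 \<notin># block_type T (insert {vs ! j, vs ! Suc j} leaf_edges) + {#weight j, weight (Suc j)#}"
    using one_notin_block_type_leaf_edges unfolding block_type_insert_spine_edge[OF assms] by simp
  then show ?thesis by simp
qed

lemma size_block_type_le:
  assumes "S \<subseteq> gedges T" and "1 \<notin># block_type T S"
  shows "size (block_type T S) \<le> length vs"
    and "size (block_type T S) = length vs \<Longrightarrow> S = leaf_edges"
proof -
  have L: "leaf_edges \<subseteq> S" using assms by (rule leaf_edges_subset_if_one_notin_block_type)
  have less: "size (block_type T S) < length vs" if "S \<noteq> leaf_edges"
    using card_blocks_strict_antimono[of leaf_edges S] that L assms(1) size_block_type_leaf_edges
    by (auto simp: size_block_type)
  show "size (block_type T S) \<le> length vs"
    using less size_block_type_leaf_edges by (cases "S = leaf_edges") auto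
  show "S = leaf_edges" if "size (block_type T S) = length vs"
    using less that by auto
qed

text \<open>The absence of part 1 forces all leaf edges into \<open>S\<close>, and the size forces
  at least one spine edge. A second one would lower the number of components again.\<close>

lemma insert_spine_edge_if_size_block_type:
  assumes S: "S \<subseteq> gedges T" and one: "1 \<notin># block_type T S"
    and size: "Suc (size (block_type T S)) = length vs"
  obtains j where "Suc j < length vs" and "S = insert {vs ! j, vs ! Suc j} leaf_edges"
proof -
  have L: "leaf_edges \<subseteq> S" using S one by (rule leaf_edges_subset_if_one_notin_block_type)
  moreover have "S \<noteq> leaf_edges" using size size_block_type_leaf_edges by auto
  ultimately obtain j where j: "Suc j < length vs" "{vs ! j, vs ! Suc j} \<in> S"
    using S unfolding edges leaf_edges_def by blast
  let ?S = "insert {vs ! j, vs ! Suc j} leaf_edges"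
  have "\<not> ?S \<subset> S"
    using card_blocks_strict_antimono[of ?S S] S size size_block_type_insert_spine_edge[OF j(1)]
    by (auto simp: size_block_type)
  then show ?thesis using that[OF j(1)] j(2) L by blast
qed

text \<open>Only one edge set has this type, so the coefficient is a single sign.\<close>

lemma type_coeff_leaf_edges: "type_coeff T (block_type T leaf_edges) \<noteq> 0"
proof -
  have "{S. S \<subseteq> gedges T \<and> block_type T S = block_type T leaf_edges} = {leaf_edges}"
  proof (intro equalityI subsetI)
    fix S assume S: "S \<in> {S. S \<subseteq> gedges T \<and> block_type T S = block_type T leaf_edges}"
    then show "S \<in> {leaf_edges}"
      using size_block_type_le(2)[of S] one_notin_block_type_leaf_edges size_block_type_leaf_edges
      by simp
  qed (use leaf_edges_subset in simp)
  then show ?thesis unfolding type_coeff_def by simp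
qed

text \<open>When weights repeat, several spine edges may produce the same type. All edge sets of
  this type have the same cardinality, so their signs agree and nothing cancels.\<close>

lemma type_coeff_insert_spine_edge:
  assumes j: "Suc j < length vs"
  shows "type_coeff T (block_type T (insert {vs ! j, vs ! Suc j} leaf_edges)) \<noteq> 0"
proof -
  let ?\<mu> = "block_type T (insert {vs ! j, vs ! Suc j} leaf_edges)"
  let ?F = "{S. S \<subseteq> gedges T \<and> block_type T S = ?\<mu>}"
  have finL: "finite leaf_edges"
    using leaf_edges_subset finite_edges by (rule finite_subset)
  have "card S = Suc (card leaf_edges)" if S: "S \<in> ?F" for S
  proof -
    have "1 \<notin># block_type T S" "Suc (size (block_type T S)) = length vs"
      using S one_notin_block_type_insert_spine_edge[OF j]
        size_block_type_insert_spine_edge[OF j] by auto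
    then obtain k where "Suc k < length vs" "S = insert {vs ! k, vs ! Suc k} leaf_edges"
      using S insert_spine_edge_if_size_block_type[of S] by blast
    then show ?thesis using finL spine_edge_notin_leaf_edges by simp
  qed
  then have "type_coeff T ?\<mu> = (\<Sum>S\<in>?F. (-1) ^ Suc (card leaf_edges))"
    unfolding type_coeff_def by (intro sum.cong) auto
  moreover have "finite ?F" using finite_edges by simp
  moreover have "{vs ! j, vs ! Suc j} \<in> gedges T" unfolding edges using j by blast
  then have "insert {vs ! j, vs ! Suc j} leaf_edges \<in> ?F" using leaf_edges_subset by simp
  ultimately have "card ?F \<noteq> 0" using card_0_eq by blast
  then show ?thesis using \<open>type_coeff T ?\<mu> = _\<close> by simp
qed

end

section \<open>Comparison of two caterpillars\<close>

lemma type_coeff_nonzeroE: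
  assumes "type_coeff G \<mu> \<noteq> 0"
  obtains S where "S \<subseteq> gedges G" and "block_type G S = \<mu>"
proof -
  have "{S. S \<subseteq> gedges G \<and> block_type G S = \<mu>} \<noteq> {}"
  proof
    assume empty: "{S. S \<subseteq> gedges G \<and> block_type G S = \<mu>} = {}"
    show False using assms unfolding type_coeff_def empty by simp
  qed
  then show ?thesis using that by blast
qed

text \<open>As \<open>a + b\<close> is neither \<open>a\<close> nor \<open>b\<close>, the partition obtained from \<open>A\<close> by merging \<open>a\<close> and \<open>b\<close>
  remembers which pair was merged.\<close>

lemma merge_pair_eq:
  fixes a b c d :: nat
  assumes "M + {#a, b#} = add_mset (a + b) A" and "M + {#c, d#} = add_mset (c + d) A"
    and "0 < a" "0 < b" "0 < c" "0 < d"
  shows "{#a, b#} = {#c, d#}"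
proof -
  have "add_mset (c + d) {#a, b#} + M = add_mset (c + d) (M + {#a, b#})" by simp
  also have "\<dots> = add_mset (a + b) (M + {#c, d#})"
    unfolding assms(1,2) by (rule add_mset_commute)
  also have "\<dots> = add_mset (a + b) {#c, d#} + M" by simp
  finally have "add_mset (c + d) {#a, b#} + M = add_mset (a + b) {#c, d#} + M" .
  then have eq: "add_mset (c + d) {#a, b#} = add_mset (a + b) {#c, d#}"
    by (rule add_right_imp_eq)
  then have "a + b \<in># add_mset (c + d) {#a, b#}" by simp
  then have "a + b = c + d" using assms(3-6) by auto
  then show ?thesis using eq by simp
qed

locale isochromatic_caterpillars =
  C: indexed_caterpillar T vs idx + C': indexed_caterpillar T' vs' idx'
  for T :: "'a sgraph" and vs idx and T' :: "'b sgraph" and vs' idx' +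
  assumes chromatic_sym_eq: "chromatic_sym T = chromatic_sym T'"
begin

lemma type_coeff_eq: "type_coeff T \<mu> = type_coeff T' \<mu>"
  using C.simple C'.simple chromatic_sym_eq by (rule type_coeff_eq_if_chromatic_sym_eq)

text \<open>The type of the leaf edges of \<open>T\<close> must also occur in \<open>T'\<close>. It
  has no part 1, so its size is at most the spine length of \<open>T'\<close>.\<close>

lemma length_spine_le: "length vs \<le> length vs'"
proof -
  have "type_coeff T' (block_type T C.leaf_edges) \<noteq> 0"
    using C.type_coeff_leaf_edges type_coeff_eq by simp
  then obtain S where "S \<subseteq> gedges T'" "block_type T' S = block_type T C.leaf_edges"
    by (rule type_coeff_nonzeroE)
  then show ?thesis
    using C'.size_block_type_le(1)[of S] C.one_notin_block_type_leaf_edges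
      C.size_block_type_leaf_edges by simp
qed

text \<open>An edge set of \<open>T'\<close> realizing this type attains the maximal number of
  components, which only the leaf edges do.\<close>

lemma leaf_types_eq:
  assumes "length vs' = length vs"
  shows "block_type T' C'.leaf_edges = block_type T C.leaf_edges"
proof -
  have "type_coeff T' (block_type T C.leaf_edges) \<noteq> 0"
    using C.type_coeff_leaf_edges type_coeff_eq by simp
  then obtain S where "S \<subseteq> gedges T'" "block_type T' S = block_type T C.leaf_edges"
    by (rule type_coeff_nonzeroE)
  then show ?thesis
    using C'.size_block_type_le(2)[of S] C.one_notin_block_type_leaf_edges
      C.size_block_type_leaf_edges assms by simp
qed

text \<open>The merged type is realized in \<open>T'\<close> by the leaf edges plus one spine edge
  \<open>k\<close>. Both merged types come from the same partition, so the merged pairs coincide;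
  they are unordered, as \<open>T'\<close> may list its spine in the opposite direction.\<close>

lemma adjacent_weights:
  assumes len: "length vs' = length vs" and j: "Suc j < length vs"
  obtains k where "Suc k < length vs'"
    and "{#C.weight j, C.weight (Suc j)#} = {#C'.weight k, C'.weight (Suc k)#}"
proof -
  let ?\<mu> = "block_type T (insert {vs ! j, vs ! Suc j} C.leaf_edges)"
  have "type_coeff T' ?\<mu> \<noteq> 0"
    using C.type_coeff_insert_spine_edge[OF j] type_coeff_eq by simp
  then obtain S where S: "S \<subseteq> gedges T'" "block_type T' S = ?\<mu>"
    by (rule type_coeff_nonzeroE)
  have "1 \<notin># block_type T' S" "Suc (size (block_type T' S)) = length vs'"
    using C.one_notin_block_type_insert_spine_edge[OF j] C.size_block_type_insert_spine_edge[OF j]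
    by (simp_all add: S(2) len)
  then obtain k where k: "Suc k < length vs'" "S = insert {vs' ! k, vs' ! Suc k} C'.leaf_edges"
    by (rule C'.insert_spine_edge_if_size_block_type[OF S(1)])
  have "?\<mu> + {#C'.weight k, C'.weight (Suc k)#} =
      add_mset (C'.weight k + C'.weight (Suc k)) (block_type T C.leaf_edges)"
    using C'.block_type_insert_spine_edge[OF k(1)] S(2) k(2) leaf_types_eq[OF len] by simp
  with C.block_type_insert_spine_edge[OF j]
  have "{#C.weight j, C.weight (Suc j)#} = {#C'.weight k, C'.weight (Suc k)#}"
    using C.weight_ge_2[of j] C.weight_ge_2[of "Suc j"] C'.weight_ge_2[of k]
      C'.weight_ge_2[of "Suc k"] j k(1)
    by (intro merge_pair_eq) auto
  then show ?thesis using that k(1) by blast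
qed

end


section \<open>Reconstruction\<close>

lemma pair_mset_eq_iff: "{#a, b#} = {#c, d#} \<longleftrightarrow> a = c \<and> b = d \<or> a = d \<and> b = c"
  by (auto simp: add_eq_conv_ex)

context isochromatic_caterpillars
begin

text \<open>Equal weights give a bijection \<open>\<sigma>\<close> of spine positions, and the
  adjacent pairs of weights show that it preserves and reflects adjacency. Equal weights also mean
  equally many leaves at matched positions, so the leaves can be matched as well.\<close>

lemma graph_iso_if_distinct_weights:
  assumes inj: "inj_on C.weight {..<length vs}" and inj': "inj_on C'.weight {..<length vs'}"
  shows "graph_iso T T'"
proof -
  \<comment> \<open>Exchanging the roles of the caterpillars supplies the reverse inequality of
    lengths and, later, the converse for adjacency.\<close>
  interpret sym: isochromatic_caterpillars T' vs' idx' T vs idx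
    by unfold_locales (simp add: chromatic_sym_eq)
  have len: "length vs' = length vs"
    using length_spine_le sym.length_spine_le by simp
  let ?I = "{..<length vs}"
  have "card {i \<in> ?I. C.weight i = k} = card {i \<in> ?I. C'.weight i = k}" for k
    using arg_cong[OF leaf_types_eq[OF len], of "\<lambda>M. count M k"] len
    unfolding C.block_type_leaf_edges C'.block_type_leaf_edges
    by (simp only: count_image_mset_set finite_lessThan)
  then obtain \<sigma> where \<sigma>: "bij_betw \<sigma> ?I ?I"
    and w\<sigma>: "\<And>i. i \<in> ?I \<Longrightarrow> C'.weight (\<sigma> i) = C.weight i"
    using ex_bij_betw_fibrewise[OF finite_lessThan finite_lessThan] by blast
  have \<sigma>_less: "\<sigma> i < length vs" if "i < length vs" for i
    using that bij_betwE[OF \<sigma>] by auto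
  have \<sigma>_eq: "\<sigma> i = \<sigma> j \<longleftrightarrow> i = j" if "i < length vs" "j < length vs" for i j
    using that \<sigma> by (auto simp: bij_betw_def inj_on_def)
  have \<sigma>_surj: "\<exists>i<length vs. \<sigma> i = k" if "k < length vs" for k
  proof -
    have "k \<in> \<sigma> ` ?I" using that \<sigma> by (simp add: bij_betw_def)
    then show ?thesis by auto
  qed
  \<comment> \<open>Here distinctness enters: a weight determines its position in \<open>T'\<close>,
    so an equality of weights becomes an equality of positions.\<close>
  have \<sigma>_eqI: "\<sigma> i = k" if "C.weight i = C'.weight k" "i < length vs" "k < length vs" for i k
    using that inj' len w\<sigma>[of i] \<sigma>_less[of i] by (auto simp: inj_on_def)
  have adj_forward: "\<sigma> (Suc j) = Suc (\<sigma> j) \<or> \<sigma> j = Suc (\<sigma> (Suc j))" if j: "Suc j < length vs" for j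
  proof -
    obtain k where k: "Suc k < length vs'"
      "{#C.weight j, C.weight (Suc j)#} = {#C'.weight k, C'.weight (Suc k)#}"
      using adjacent_weights[OF len j] by blast
    then have "C.weight j = C'.weight k \<and> C.weight (Suc j) = C'.weight (Suc k) \<or>
        C.weight j = C'.weight (Suc k) \<and> C.weight (Suc j) = C'.weight k"
      by (simp add: pair_mset_eq_iff)
    then have "\<sigma> j = k \<and> \<sigma> (Suc j) = Suc k \<or> \<sigma> j = Suc k \<and> \<sigma> (Suc j) = k"
      using \<sigma>_eqI[of j] \<sigma>_eqI[of "Suc j"] k(1) j len by auto
    then show ?thesis by auto
  qed
  have adj_backward: "i = Suc j \<or> j = Suc i"
    if ij: "i < length vs" "j < length vs" "\<sigma> j = Suc (\<sigma> i)" for i j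
  proof -
    have k: "Suc (\<sigma> i) < length vs'" using ij \<sigma>_less[of j] len by simp
    obtain l where l: "Suc l < length vs"
      "{#C'.weight (\<sigma> i), C'.weight (Suc (\<sigma> i))#} = {#C.weight l, C.weight (Suc l)#}"
      using sym.adjacent_weights[OF len[symmetric] k] by blast
    then have "C.weight l = C'.weight (\<sigma> i) \<and> C.weight (Suc l) = C'.weight (\<sigma> j) \<or>
        C.weight l = C'.weight (\<sigma> j) \<and> C.weight (Suc l) = C'.weight (\<sigma> i)"
      using ij(3) by (auto simp: pair_mset_eq_iff)
    then have "\<sigma> l = \<sigma> i \<and> \<sigma> (Suc l) = \<sigma> j \<or> \<sigma> l = \<sigma> j \<and> \<sigma> (Suc l) = \<sigma> i"
      using \<sigma>_eqI[of l] \<sigma>_eqI[of "Suc l"] \<sigma>_less[of i] \<sigma>_less[of j] ij(1,2) l(1) by auto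
    then show ?thesis using \<sigma>_eq[of l] \<sigma>_eq[of "Suc l"] ij(1,2) l(1) by auto
  qed
  have adj: "(j = Suc i \<or> i = Suc j) \<longleftrightarrow> (\<sigma> j = Suc (\<sigma> i) \<or> \<sigma> i = Suc (\<sigma> j))"
    if "i < length vs" "j < length vs" for i j
    using that adj_forward[of i] adj_forward[of j] adj_backward[of i j] adj_backward[of j i] by auto
  let ?L = "gverts T - set vs" and ?L' = "gverts T' - set vs'"
  have "card {u \<in> ?L. \<sigma> (idx u) = k} = card {u \<in> ?L'. idx' u = k}" for k
  proof (cases "k < length vs")
    case True
    then obtain i where i: "i < length vs" "\<sigma> i = k" using \<sigma>_surj by blast
    \<comment> \<open>Removing the spine vertex from the star leaves its leaves, so equal weights
      yield equal leaf counts.\<close>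
    have "{v \<in> gverts T. idx v = i} = insert (vs ! i) {u \<in> ?L. \<sigma> (idx u) = k}"
      using i \<sigma>_eq C.idx_less C.nth_idx C.idx_nth[OF i(1)] C.nth_vert[OF i(1)] by auto
    then have "C.weight i = Suc (card {u \<in> ?L. \<sigma> (idx u) = k})"
      unfolding C.weight_def using i(1) C.finite_verts by simp
    moreover have "{v \<in> gverts T'. idx' v = k} = insert (vs' ! k) {u \<in> ?L'. idx' u = k}"
      using True len C'.nth_idx C'.idx_nth[of k] C'.nth_vert[of k] by auto
    then have "C'.weight k = Suc (card {u \<in> ?L'. idx' u = k})"
      unfolding C'.weight_def using True len C'.finite_verts by simp
    ultimately show ?thesis using w\<sigma>[of i] i by simp
  next
    case False
    then have "{u \<in> ?L. \<sigma> (idx u) = k} = {}" "{u \<in> ?L'. idx' u = k} = {}"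
      using C.idx_less \<sigma>_less C'.idx_less len by auto
    then show ?thesis by (simp only: card.empty)
  qed
  then obtain \<tau> where \<tau>: "bij_betw \<tau> ?L ?L'" and idx\<tau>: "\<And>u. u \<in> ?L \<Longrightarrow> idx' (\<tau> u) = \<sigma> (idx u)"
    using ex_bij_betw_fibrewise[of ?L ?L' "\<lambda>u. \<sigma> (idx u)" idx'] C.finite_verts C'.finite_verts
    by blast
  define f where "f v = (if v \<in> set vs then vs' ! \<sigma> (idx v) else \<tau> v)" for v
  have idx_f: "idx' (f v) = \<sigma> (idx v)" if "v \<in> gverts T" for v
    using that idx\<tau>[of v] C'.idx_nth \<sigma>_less C.idx_less len by (simp add: f_def)
  have spine_f: "f v \<in> set vs' \<longleftrightarrow> v \<in> set vs" if "v \<in> gverts T" for v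
    using that bij_betwE[OF \<tau>] \<sigma>_less C.idx_less len by (auto simp: f_def)
  have "bij_betw f (set vs \<union> ?L) (set vs' \<union> ?L')"
  proof (rule bij_betw_combine)
    show "bij_betw f ?L ?L'"
      using \<tau> by (rule bij_betw_cong[THEN iffD1, rotated]) (simp add: f_def)
    have "inj_on f (set vs)"
    proof (rule inj_onI)
      fix u v assume uv: "u \<in> set vs" "v \<in> set vs" "f u = f v"
      then have "\<sigma> (idx u) = \<sigma> (idx v)" using idx_f C.spine_verts by (metis subsetD)
      then have "idx u = idx v" using \<sigma>_eq C.idx_less uv C.spine_verts by blast
      then show "u = v" using C.nth_idx uv by metis
    qed
    moreover have "f ` set vs = set vs'"
    proof
      show "f ` set vs \<subseteq> set vs'" using spine_f C.spine_verts by auto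
      show "set vs' \<subseteq> f ` set vs"
      proof
        fix x assume "x \<in> set vs'"
        then obtain k where k: "k < length vs" "x = vs' ! k" using len by (metis in_set_conv_nth)
        then obtain i where i: "i < length vs" "\<sigma> i = k" using \<sigma>_surj by blast
        then have "f (vs ! i) = x" using k by (simp add: f_def C.idx_nth)
        then show "x \<in> f ` set vs" using i by (metis image_eqI nth_mem)
      qed
    qed
    ultimately show "bij_betw f (set vs) (set vs')" by (simp add: bij_betw_def)
  qed auto
  then have bij: "bij_betw f (gverts T) (gverts T')"
    using C.spine_verts C'.spine_verts by (simp add: Un_absorb1)
  have "gadj T u v \<longleftrightarrow> gadj T' (f u) (f v)" if uv: "u \<in> gverts T" "v \<in> gverts T" for u v
  proof -
    have f: "f u \<in> gverts T'" "f v \<in> gverts T'" using uv bij_betwE[OF bij] by auto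
    have "idx u < length vs" "idx v < length vs" using uv C.idx_less by auto
    then show ?thesis
      unfolding C.gadj_iff[OF uv] C'.gadj_iff[OF f] idx_f[OF uv(1)] idx_f[OF uv(2)]
        spine_f[OF uv(1)] spine_f[OF uv(2)]
      using adj[of "idx u" "idx v"] \<sigma>_eq[of "idx u" "idx v"] by simp
  qed
  then show ?thesis using bij unfolding graph_iso_def by blast
qed

end

section \<open>Spine positions in a caterpillar\<close>

lemma leaf_edge_unique:
  assumes "u \<in> leaves T" "e \<in> gedges T" "u \<in> e" "e' \<in> gedges T" "u \<in> e'"
  shows "e = e'"
proof -
  have "card {e \<in> gedges T. u \<in> e} = 1" using assms(1) by (simp add: leaves_def gdegree_def)
  then obtain d where "{e \<in> gedges T. u \<in> e} = {d}" by (auto simp: card_1_singleton_iff)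
  then have "e \<in> {d}" "e' \<in> {d}" using assms(2-5) by auto
  then show ?thesis by simp
qed

text \<open>A walk starting at \<open>u\<close> can only alternate between \<open>u\<close> and
  \<open>w\<close>, because neither has another edge. By connectedness these are all the
  vertices.\<close>

lemma adjacent_leaves_absorb:
  assumes "gconnected T" and "u \<in> leaves T" "w \<in> leaves T" "{u, w} \<in> gedges T" and "x \<in> gverts T"
  shows "x \<in> {u, w}"
proof -
  have "u \<in> gverts T" using assms(2) by (simp add: leaves_def)
  then obtain p where p: "gwalk T p" "hd p = u" "last p = x"
    using assms(1,5) unfolding gconnected_def by blast
  have "p \<noteq> []" using p(1) by (simp add: gwalk_def)
  have "i < length p \<longrightarrow> p ! i \<in> {u, w}" for i
  proof (induction i)
    case 0
    then show ?case using p(2) \<open>p \<noteq> []\<close> by (simp add: hd_conv_nth)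
  next
    case (Suc i)
    show ?case
    proof
      assume i: "Suc i < length p"
      then have mem: "p ! i \<in> {u, w}" using Suc by simp
      have "{p ! i, p ! Suc i} \<in> gedges T"
        using i p(1) by (simp add: gwalk_def gadj_def)
      then have "{p ! i, p ! Suc i} = {u, w}"
        using leaf_edge_unique[of "p ! i" T] mem assms(2-4) by blast
      then show "p ! Suc i \<in> {u, w}" by blast
    qed
  qed
  from this[of "length p - 1"] show ?thesis
    using p(3) \<open>p \<noteq> []\<close> by (simp add: last_conv_nth)
qed

text \<open>A spine vertex gets its own position, a leaf the position of its unique neighbor. The
  \<open>Suc\<close> counts the spine vertex itself, so positive leaf numbers make every fibre have
  at least two elements.\<close>

lemma caterpillar_indexing:
  assumes "caterpillar T" and spine: "is_spine T vs" and pos: "\<forall>i < length vs. 0 < leaf_number T vs i"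
  obtains idx where "indexed_caterpillar T vs idx"
    and "\<And>i. i < length vs \<Longrightarrow> card {v \<in> gverts T. idx v = i} = Suc (leaf_number T vs i)"
proof -
  have simple: "simple_graph T" and conn: "gconnected T"
    using assms(1) by (auto simp: caterpillar_def is_tree_def)
  have dist: "distinct vs" and len: "2 \<le> length vs"
    and ind: "ginduced T (gverts T - leaves T) = path_graph vs"
    using spine by (auto simp: is_spine_def)
  have nonleaf: "gverts T - leaves T = set vs"
    using arg_cong[OF ind, of gverts] by (auto simp: ginduced_def path_graph_def)
  have spine_edges: "{e \<in> gedges T. e \<subseteq> set vs} = {{vs ! i, vs ! Suc i} | i. Suc i < length vs}"
    using arg_cong[OF ind, of gedges] unfolding nonleaf by (simp add: ginduced_def path_graph_def)
  have leaf: "u \<in> leaves T" if "u \<in> gverts T" "u \<notin> set vs" for u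
    using that nonleaf by blast
  have "\<exists>i. i < length vs \<and> (if v \<in> set vs then vs ! i = v else {v, vs ! i} \<in> gedges T)"
    if v: "v \<in> gverts T" for v
  proof (cases "v \<in> set vs")
    case True
    then show ?thesis by (simp add: in_set_conv_nth)
  next
    case False
    then have "card {e \<in> gedges T. v \<in> e} = 1"
      using leaf[OF v] by (simp add: leaves_def gdegree_def)
    then have "{e \<in> gedges T. v \<in> e} \<noteq> {}" using card.empty by fastforce
    then obtain e where e: "e \<in> gedges T" "v \<in> e" by blast
    then have "card e = 2" "e \<subseteq> gverts T" using simple by (auto simp: simple_graph_def)
    then obtain w where w: "e = {v, w}" "w \<in> gverts T"
      using e(2) by (auto simp: card_2_iff)
    have vs0: "vs ! 0 \<in> set vs" using len by (intro nth_mem) linarith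
    \<comment> \<open>If the neighbor \<open>w\<close> were a leaf too, the whole tree would be
      \<open>{v, w}\<close>, leaving no room for the spine vertex \<open>vs ! 0\<close>.\<close>
    have "w \<in> set vs"
    proof (rule ccontr)
      assume "w \<notin> set vs"
      then have "vs ! 0 \<in> {v, w}"
        using adjacent_leaves_absorb[OF conn leaf[OF v False] leaf[OF w(2)]] e(1) w(1) vs0 nonleaf
        by blast
      then show False using False \<open>w \<notin> set vs\<close> vs0 by auto
    qed
    then obtain i where "i < length vs" "w = vs ! i" by (auto simp: in_set_conv_nth)
    then show ?thesis using False e(1) w(1) by auto
  qed
  then obtain idx where idx: "\<And>v. v \<in> gverts T \<Longrightarrow> idx v < length vs \<and>
      (if v \<in> set vs then vs ! idx v = v else {v, vs ! idx v} \<in> gedges T)"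
    by metis
  have idx_nth: "idx (vs ! i) = i" if i: "i < length vs" for i
  proof -
    have "vs ! i \<in> set vs" "vs ! i \<in> gverts T" using i nonleaf by auto
    then have "idx (vs ! i) < length vs" "vs ! idx (vs ! i) = vs ! i" using idx[of "vs ! i"] by auto
    then show ?thesis using i dist by (simp add: nth_eq_iff_index_eq)
  qed
  have card: "card {v \<in> gverts T. idx v = i} = Suc (leaf_number T vs i)" if i: "i < length vs" for i
  proof -
    have "vs ! i \<in> gverts T - leaves T" unfolding nonleaf using i by simp
    then have vsi: "vs ! i \<in> gverts T" "vs ! i \<notin> leaves T" by auto
    have "{v \<in> gverts T. idx v = i} = insert (vs ! i) {u \<in> leaves T. gadj T (vs ! i) u}"
    proof (intro equalityI subsetI)
      fix v assume "v \<in> {v \<in> gverts T. idx v = i}"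
      then show "v \<in> insert (vs ! i) {u \<in> leaves T. gadj T (vs ! i) u}"
        using idx[of v] leaf[of v] by (auto simp: gadj_def insert_commute split: if_splits)
    next
      fix v assume v: "v \<in> insert (vs ! i) {u \<in> leaves T. gadj T (vs ! i) u}"
      show "v \<in> {v \<in> gverts T. idx v = i}"
      proof (cases "v = vs ! i")
        case True
        then show ?thesis using vsi idx_nth[OF i] by simp
      next
        case False
        then have vl: "v \<in> leaves T" "{v, vs ! i} \<in> gedges T"
          using v by (auto simp: gadj_def insert_commute)
        then have "v \<in> gverts T" "v \<notin> set vs"
          unfolding nonleaf[symmetric] by (auto simp: leaves_def)
        then have vi: "idx v < length vs" "{v, vs ! idx v} \<in> gedges T" using idx[of v] by auto
        then have "{v, vs ! idx v} = {v, vs ! i}" using leaf_edge_unique[OF vl(1)] vl(2) by blast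
        then have "vs ! idx v = vs ! i" by (auto simp: doubleton_eq_iff)
        then have "idx v = i" using dist i vi(1) by (simp add: nth_eq_iff_index_eq)
        then show ?thesis using \<open>v \<in> gverts T\<close> by simp
      qed
    qed
    moreover have "finite {u \<in> leaves T. gadj T (vs ! i) u}"
      using simple by (auto simp: leaves_def simple_graph_def)
    ultimately show ?thesis using vsi(2) by (simp add: leaf_number_def)
  qed
  have "gedges T = {{vs ! i, vs ! Suc i} | i. Suc i < length vs} \<union>
      {{u, vs ! idx u} | u. u \<in> gverts T - set vs}"
  proof (intro equalityI subsetI)
    fix e assume e: "e \<in> gedges T"
    show "e \<in> {{vs ! i, vs ! Suc i} | i. Suc i < length vs} \<union>
      {{u, vs ! idx u} | u. u \<in> gverts T - set vs}"
    proof (cases "e \<subseteq> set vs")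
      case True
      then show ?thesis using e spine_edges by blast
    next
      case False
      then obtain u where u: "u \<in> e" "u \<notin> set vs" by blast
      have "u \<in> gverts T" using u e simple by (auto simp: simple_graph_def)
      moreover from this have "{u, vs ! idx u} \<in> gedges T" using idx[of u] u by simp
      ultimately have "e = {u, vs ! idx u}"
        using leaf_edge_unique[OF leaf[OF _ u(2)] e u(1)] by blast
      then show ?thesis using u(2) \<open>u \<in> gverts T\<close> by blast
    qed
  next
    fix e assume "e \<in> {{vs ! i, vs ! Suc i} | i. Suc i < length vs} \<union>
      {{u, vs ! idx u} | u. u \<in> gverts T - set vs}"
    then show "e \<in> gedges T"
    proof
      assume "e \<in> {{vs ! i, vs ! Suc i} | i. Suc i < length vs}"
      then show ?thesis using spine_edges by blast
    next
      assume "e \<in> {{u, vs ! idx u} | u. u \<in> gverts T - set vs}"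
      then obtain u where "u \<in> gverts T" "u \<notin> set vs" "e = {u, vs ! idx u}" by blast
      then show ?thesis using idx[of u] by simp
    qed
  qed
  then have "indexed_caterpillar T vs idx"
    using simple dist nonleaf idx idx_nth card pos
    by unfold_locales (auto simp: Suc_le_eq)
  then show ?thesis using that card by blast
qed

theorem theorem4p2:
  fixes T :: "'a sgraph" and T' :: "'b sgraph"
    and vs :: "'a list" and vs' :: "'b list"
  assumes "caterpillar T" and "is_spine T vs"
    and "caterpillar T'" and "is_spine T' vs'"
    and "\<forall>i < length vs. 0 < leaf_number T vs i"
    and "inj_on (leaf_number T vs) {..<length vs}"
    and "\<forall>i < length vs'. 0 < leaf_number T' vs' i"
    and "inj_on (leaf_number T' vs') {..<length vs'}"
    and "chromatic_sym T = chromatic_sym T'"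
  shows "graph_iso T T'"
proof -
  obtain idx where idx: "indexed_caterpillar T vs idx"
    and card: "\<And>i. i < length vs \<Longrightarrow> card {v \<in> gverts T. idx v = i} = Suc (leaf_number T vs i)"
    using caterpillar_indexing[OF assms(1,2,5)] by blast
  obtain idx' where idx': "indexed_caterpillar T' vs' idx'"
    and card': "\<And>i. i < length vs' \<Longrightarrow> card {v \<in> gverts T'. idx' v = i} = Suc (leaf_number T' vs' i)"
    using caterpillar_indexing[OF assms(3,4,7)] by blast
  interpret isochromatic_caterpillars T vs idx T' vs' idx'
    using idx idx' assms(9)
    by (intro isochromatic_caterpillars.intro isochromatic_caterpillars_axioms.intro)
  show ?thesis
  proof (rule graph_iso_if_distinct_weights)
    \<comment> \<open>Weights are leaf numbers plus one, so distinctness carries over.\<close>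
    show "inj_on C.weight {..<length vs}"
      using assms(6) card by (auto simp: inj_on_def C.weight_def)
    show "inj_on C'.weight {..<length vs'}"
      using assms(8) card' by (auto simp: inj_on_def C'.weight_def)
  qed
qed

end
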